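(* Let $\Omega$ be a bounded domain in $\mathbb{R}^n$, $n\ge 3$, with smooth and disconnected boundary $\partial\Omega$. Suppose that $2\le k\le n$. Then the problem $$\sigma_k(\lambda(-A^u))=N_k,\quad \lambda(-A^u)\in\Gamma_k,\quad u>0\quad\text{in }\Omega,\qquad u(x)\to\infty\ \text{ as } d(x)\to 0,$$ understood in the viscosity sense, has no positive solution in $C^1(\Omega)$. In particular, the unique locally Lipschitz viscosity solution of this problem does not belong to $C^1(\Omega)$.
   Context: Notation. $d(x)=\mathrm{dist}(x,\partial\Omega)$ and $N_k=2^{-k}\binom{n}{k}$. For a positive $C^2$ function $u$ on an open subset of $\mathbb{R}^n$ its conformal Hessian is $$A^{u}=-\frac{2}{n-2}u^{-\frac{n+2}{n-2}}\nabla^2u+\frac{2n}{(n-2)^2}u^{-\frac{2n}{n-2}}\nabla u\otimes\nabla u-\frac{2}{(n-2)^2}u^{-\frac{2n}{n-2}}|\nabla u|^2 I ,$$ and $\lambda(M)$ denotes the eigenvalues of a symmetric matrix $M$. $\sigma_k$ is the $k$-th elementary symmetric function on $\mathbb{R}^n$ and $\Gamma_k=\{\lambda\in\mathbb{R}^n:\sigma_1(\lambda)>0,\dots,\sigma_k(\lambda)>0\}$. Viscosity solutions. A positive continuous function $u$ on $\Omega$ is a viscosity solution of $\sigma_k(\lambda(-A^u))=N_k$, $\lambda(-A^u)\in\Gamma_k$ in $\Omega$ if for every $x_0\in\Omega$ and every positive $C^2$ function $\varphi$ defined near $x_0$ with $\varphi(x_0)=u(x_0)$: (i) if $u\le\varphi$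 near $x_0$, then $\lambda(-A^\varphi(x_0))\in\Gamma_k$ and $\sigma_k(\lambda(-A^\varphi(x_0)))\ge N_k$; (ii) if $u\ge\varphi$ near $x_0$, then $\lambda(-A^\varphi(x_0))\notin\{\lambda\in\Gamma_k:\sigma_k(\lambda)>N_k\}$. It is known that the boundary value problem has a unique continuous positive viscosity solution, and that this solution is locally Lipschitz in $\Omega$. *)

theory Defs
  imports "HOL-Analysis.Analysis"
begin

section \<open>Classes of differentiable functions\<close>

definition partial_deriv :: "'n \<Rightarrow> (real^'n::finite \<Rightarrow> real) \<Rightarrow> real^'n \<Rightarrow> real" where
  "partial_deriv i f x = frechet_derivative f (at x) (axis i 1)"

text \<open>\<open>C^m\<close> on \<open>U\<close>; meant for open \<open>U\<close> only.\<close>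

primrec Ck_on :: "nat \<Rightarrow> (real^'n::finite) set \<Rightarrow> (real^'n \<Rightarrow> real) \<Rightarrow> bool" where
  "Ck_on 0 U f \<longleftrightarrow> continuous_on U f"
| "Ck_on (Suc m) U f \<longleftrightarrow>
     (\<forall>x\<in>U. f differentiable (at x)) \<and> (\<forall>i. Ck_on m U (partial_deriv i f))"

definition smooth_on :: "(real^'n::finite) set \<Rightarrow> (real^'n \<Rightarrow> real) \<Rightarrow> bool" where
  "smooth_on U f \<longleftrightarrow> (\<forall>m. Ck_on m U f)"

definition grad :: "(real^'n::finite \<Rightarrow> real) \<Rightarrow> real^'n \<Rightarrow> real^'n" where
  "grad f x = (\<chi> i. partial_deriv i f x)"

definition hessian :: "(real^'n::finite \<Rightarrow> real) \<Rightarrow> real^'n \<Rightarrow> real^'n^'n" where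
  "hessian f x = (\<chi> i j. partial_deriv i (partial_deriv j f) x)"

definition locally_lipschitz_on :: "(real^'n::finite) set \<Rightarrow> (real^'n \<Rightarrow> real) \<Rightarrow> bool" where
  "locally_lipschitz_on U f \<longleftrightarrow>
     (\<forall>x\<in>U. \<exists>r>0. \<exists>L. L-lipschitz_on (ball x r \<inter> U) f)"


section \<open>Domains with smooth boundary\<close>

text \<open>Near each boundary point the domain is the sublevel set of a smooth function with
  nonvanishing gradient.\<close>

definition smooth_boundary :: "(real^'n::finite) set \<Rightarrow> bool" where
  "smooth_boundary \<Omega> \<longleftrightarrow>
     (\<forall>p\<in>frontier \<Omega>. \<exists>V \<rho>. open V \<and> p \<in> V \<and> smooth_on V \<rho> \<and>
        (\<forall>x\<in>V. grad \<rho> x \<noteq> 0) \<and>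
        \<Omega> \<inter> V = {x\<in>V. \<rho> x < 0} \<and>
        frontier \<Omega> \<inter> V = {x\<in>V. \<rho> x = 0})"


section \<open>The \<open>\<sigma>\<^sub>k\<close> operator of the conformal Hessian\<close>

definition outer :: "real^'n::finite \<Rightarrow> real^'n \<Rightarrow> real^'n^'n" where
  "outer v w = (\<chi> i j. v $ i * w $ j)"

definition conformal_hessian :: "(real^'n::finite \<Rightarrow> real) \<Rightarrow> real^'n \<Rightarrow> real^'n^'n" where
  "conformal_hessian u x = (let n = real CARD('n) in
      (- (2 / (n - 2)) * u x powr (- ((n + 2) / (n - 2)))) *\<^sub>R hessian u x
    + (2 * n / (n - 2)\<^sup>2 * u x powr (- (2 * n / (n - 2)))) *\<^sub>R outer (grad u x) (grad u x)
    - (2 / (n - 2)\<^sup>2 * u x powr (- (2 * n / (n - 2))) * (norm (grad u x))\<^sup>2) *\<^sub>R mat 1)"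

text \<open>\<open>is_spectrum M l\<close>: the entries of \<open>l\<close> are the roots of the characteristic polynomial
  of \<open>M\<close>, listed with multiplicity.\<close>

definition is_spectrum :: "real^'n^'n::finite \<Rightarrow> real^'n \<Rightarrow> bool" where
  "is_spectrum M l \<longleftrightarrow> (\<forall>t::real. det (t *\<^sub>R mat 1 - M) = (\<Prod>i\<in>UNIV. t - l $ i))"

text \<open>The eigenvalues are determined up to order for symmetric \<open>M\<close>, and are only used
  below through symmetric functions, so the order that is picked is immaterial.  For a
  non-symmetric \<open>M\<close> the value may be unspecified.\<close>

definition eigvals :: "real^'n^'n::finite \<Rightarrow> real^'n" where
  "eigvals M = (SOME l. is_spectrum M l)"

definition sigma :: "nat \<Rightarrow> real^'n::finite \<Rightarrow> real" where
  "sigma k l = (\<Sum>S | card S = k. \<Prod>i\<in>S. l $ i)"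

definition Gamma_cone :: "nat \<Rightarrow> (real^'n::finite) set" where
  "Gamma_cone k = {l. \<forall>j\<in>{1..k}. sigma j l > 0}"

definition N_const :: "'n itself \<Rightarrow> nat \<Rightarrow> real" where
  "N_const _ k = real (CARD('n) choose k) / 2 ^ k"


section \<open>Viscosity solutions\<close>

definition test_function_at ::
    "(real^'n::finite \<Rightarrow> real) \<Rightarrow> real^'n \<Rightarrow> (real^'n \<Rightarrow> real) \<Rightarrow> bool" where
  "test_function_at u x0 \<phi> \<longleftrightarrow>
     (\<exists>U. open U \<and> x0 \<in> U \<and> Ck_on 2 U \<phi> \<and> (\<forall>x\<in>U. \<phi> x > 0)) \<and> \<phi> x0 = u x0"

definition viscosity_solution ::
    "nat \<Rightarrow> (real^'n::finite) set \<Rightarrow> (real^'n \<Rightarrow> real) \<Rightarrow> bool" where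
  "viscosity_solution k \<Omega> u \<longleftrightarrow>
     continuous_on \<Omega> u \<and> (\<forall>x\<in>\<Omega>. u x > 0) \<and>
     (\<forall>x0\<in>\<Omega>. \<forall>\<phi>. test_function_at u x0 \<phi> \<longrightarrow>
        ((\<forall>\<^sub>F x in nhds x0. u x \<le> \<phi> x) \<longrightarrow>
           eigvals (- conformal_hessian \<phi> x0) \<in> Gamma_cone k \<and>
           sigma k (eigvals (- conformal_hessian \<phi> x0)) \<ge> N_const TYPE('n) k) \<and>
        ((\<forall>\<^sub>F x in nhds x0. u x \<ge> \<phi> x) \<longrightarrow>
           eigvals (- conformal_hessian \<phi> x0)
             \<notin> {l \<in> Gamma_cone k. sigma k l > N_const TYPE('n) k}))"

definition blows_up_at_boundary :: "(real^'n::finite) set \<Rightarrow> (real^'n \<Rightarrow> real) \<Rightarrow> bool" where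
  "blows_up_at_boundary \<Omega> u \<longleftrightarrow>
     (\<forall>M. \<exists>\<delta>>0. \<forall>x\<in>\<Omega>. infdist x (frontier \<Omega>) < \<delta> \<longrightarrow> u x > M)"

definition bvp_solution :: "nat \<Rightarrow> (real^'n::finite) set \<Rightarrow> (real^'n \<Rightarrow> real) \<Rightarrow> bool" where
  "bvp_solution k \<Omega> u \<longleftrightarrow> viscosity_solution k \<Omega> u \<and> blows_up_at_boundary \<Omega> u"

end

theory Submission
  imports Defs "HOL-Computational_Algebra.Polynomial" "HOL-Library.Function_Algebras"
begin

text \<open>Only the subsolution half of the viscosity condition and \<open>\<Gamma>\<^sub>k \<subseteq> \<Gamma>\<^sub>2\<close> are needed. For
  \<open>\<lambda> \<in> \<Gamma>\<^sub>2\<close> every \<open>\<sigma>\<^sub>1(\<lambda>) - \<lambda>\<^sub>i\<close> is positive, so with \<open>u = exp ((n - 2) w / 2)\<close> the traces of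
  \<open>\<nabla>\<^sup>2w - \<nabla>w \<otimes> \<nabla>w + |\<nabla>w|\<^sup>2 I / 2\<close> over all hyperplanes are positive in the viscosity sense. Adding
  \<open>\<epsilon> |x|\<^sup>2\<close> to \<open>w\<close> makes them uniformly positive wherever the gradient is small, and in particular
  \<open>V = exp (- w - \<epsilon> |x|\<^sup>2)\<close> has no local minimum. If the boundary is disconnected, then at a mountain
  pass level \<open>c\<close> the set \<open>{V < c}\<close> is a disjoint union of open sets \<open>E\<close>, \<open>F\<close> whose closures meet
  inside \<open>\<Omega>\<close>. Maximise \<open>(c - V x) (c - V y) exp (- N |x - y|\<^sup>2)\<close> over \<open>x \<in> E\<close>, \<open>y \<in> F\<close> with \<open>N\<close>
  large. At the maximiser \<open>(p, q)\<close> the gradients of \<open>V\<close> are opposite multiples of \<open>p - q\<close>; since \<open>V\<close>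
  is \<open>C\<^sup>1\<close> and \<open>|p - q|\<close> is small, they are nearly equal, hence both small. Therefore
  \<open>ln (c - V (p + v))\<close> and \<open>ln (c - V (q + v))\<close> are strictly subharmonic viscosity functions of \<open>v\<close>
  in the hyperplane orthogonal to \<open>p - q\<close>, while their sum has a local maximum at \<open>v = 0\<close>: a
  contradiction.\<close>

section \<open>Spectra of symmetric matrices\<close>

text \<open>The quadratic penalty does not change when both points move by the same v, so only the
  sum of two functions of the single variable v has to be excluded from having a maximum, and u
  needs no second derivatives. In place of a theorem on sums, a harmonic function close to the
  boundary values of one summand serves as a barrier for it, and its negative as a barrier for the
  other. Harmonic extensions of polynomials, with uniform approximation on a sphere, supply it.

  Hyperplanes are forced. The gradient of V is small at p and q, but that of ln (c - V) is 2 N (p -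
  q) up to sign, which has no such bound. Passing from V to ln (c - V) costs the square of its
  derivative in every direction that enters the trace, so only directions orthogonal to p - q are
  affordable. This is where k \<ge> 2 matters: \<Gamma>_1 controls the full trace alone, \<Gamma>_2
  the trace over each hyperplane.\<close>

lemma self_adjoint_top_eigenvector:
  fixes f :: "'a::euclidean_space \<Rightarrow> 'a"
  assumes f: "linear f" and sa: "\<And>x y. f x \<bullet> y = x \<bullet> f y"
    and S: "subspace S" and inv: "f ` S \<subseteq> S" and ne: "S \<noteq> {0}"
  obtains v l where "v \<in> S" "norm v = 1" "f v = l *\<^sub>R v"
proof -
  have [simp]: "0 \<in> S" using S by (rule subspace_0)
  then obtain s where s: "s \<in> S" "s \<noteq> 0" using ne by blast
  have ne': "sphere 0 1 \<inter> S \<noteq> {}"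
  proof -
    have "(1 / norm s) *\<^sub>R s \<in> sphere 0 1 \<inter> S"
      using s S by (auto simp: subspace_scale)
    then show ?thesis by blast
  qed
  have "compact (sphere 0 1 \<inter> S)"
    using closed_subspace[OF S] by (intro compact_Int_closed) auto
  moreover have "continuous_on (sphere 0 1 \<inter> S) (\<lambda>x. x \<bullet> f x)"
    by (intro continuous_intros linear_continuous_on) (simp add: f linear_linear)
  ultimately have "\<exists>v\<in>sphere 0 1 \<inter> S. \<forall>x\<in>sphere 0 1 \<inter> S. x \<bullet> f x \<le> v \<bullet> f v"
    using ne' by (intro continuous_attains_sup)
  then obtain v where v: "v \<in> sphere 0 1 \<inter> S"
      and mx: "\<And>x. x \<in> sphere 0 1 \<inter> S \<Longrightarrow> x \<bullet> f x \<le> v \<bullet> f v" by blast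
  define l where "l = v \<bullet> f v"
  have vv: "v \<bullet> v = 1" "v \<in> S" "norm v = 1" using v by (auto simp: dot_square_norm)
  have quad: "x \<bullet> f x \<le> l * (x \<bullet> x)" if "x \<in> S" for x
  proof (cases "x = 0")
    case False
    have "((1 / norm x) *\<^sub>R x) \<bullet> f ((1 / norm x) *\<^sub>R x) \<le> l"
      unfolding l_def using that False S by (intro mx) (auto simp: subspace_scale)
    then have "(x \<bullet> f x) / (norm x)\<^sup>2 \<le> l"
      using f by (simp add: linear_cmul power2_eq_square)
    then show ?thesis
      using False by (simp add: dot_square_norm divide_le_eq)
  qed (simp add: f linear_0)
  \<comment> \<open>The residual w is orthogonal to v. Moving from the maximiser v towards w raises
    the quadratic form at the first order rate 2 (w . w), while the norm changes only at second
    order; so w must vanish.\<close>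
  define w where "w = f v - l *\<^sub>R v"
  have wS: "w \<in> S" unfolding w_def using inv vv S by (intro subspace_diff) (auto simp: subspace_scale)
  have wv: "w \<bullet> v = 0" by (simp add: w_def inner_diff_left vv l_def inner_commute[of "f v"])
  have "f v = w + l *\<^sub>R v" by (simp add: w_def)
  then have wf: "w \<bullet> f v = w \<bullet> w" by (simp add: inner_add_right wv)
  have ineq: "2 * t * (w \<bullet> w) + t\<^sup>2 * (w \<bullet> f w) \<le> l * t\<^sup>2 * (w \<bullet> w)" for t
  proof -
    have i: "(v + t *\<^sub>R w) \<bullet> f (v + t *\<^sub>R w) \<le> l * ((v + t *\<^sub>R w) \<bullet> (v + t *\<^sub>R w))"
      using vv wS S by (intro quad) (auto intro!: subspace_add subspace_scale)
    have e1: "(v + t *\<^sub>R w) \<bullet> f (v + t *\<^sub>R w) = l + 2 * t * (w \<bullet> w) + t\<^sup>2 * (w \<bullet> f w)"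
      using wf sa[of v w]
      by (simp add: f linear_add linear_cmul inner_add_left inner_add_right l_def
          power2_eq_square inner_commute algebra_simps)
    have e2: "(v + t *\<^sub>R w) \<bullet> (v + t *\<^sub>R w) = 1 + t\<^sup>2 * (w \<bullet> w)"
      using wv vv by (simp add: inner_add_left inner_add_right power2_eq_square inner_commute)
    show ?thesis using i unfolding e1 e2 by (simp add: distrib_left mult.assoc)
  qed
  have "w \<bullet> w = 0"
  proof (rule ccontr)
    assume "w \<bullet> w \<noteq> 0"
    then have pos: "w \<bullet> w > 0" by simp
    define c where "c = l * (w \<bullet> w) - w \<bullet> f w"
    have "2 * (w \<bullet> w) \<le> t * c" if "t > 0" for t
    proof -
      have "t * (2 * (w \<bullet> w)) \<le> t * (t * c)"
        using ineq[of t] by (simp add: c_def power2_eq_square algebra_simps)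
      then show ?thesis using that by simp
    qed
    from this[of "(w \<bullet> w) / (1 + \<bar>c\<bar>)"] have "2 * (w \<bullet> w) \<le> (w \<bullet> w) / (1 + \<bar>c\<bar>) * c"
      using pos by (simp add: add_nonneg_pos)
    moreover have "(w \<bullet> w) / (1 + \<bar>c\<bar>) * c \<le> (w \<bullet> w) * 1"
      using pos by (simp add: divide_le_eq mult_left_mono)
    ultimately show False using pos by simp
  qed
  then have "f v = l *\<^sub>R v" by (simp add: w_def)
  with vv that show thesis by blast
qed

text \<open>Eigenvectors are split off one at a time: self-adjointness keeps the orthogonal
  complement of v inside S invariant, and its dimension is smaller.\<close>

lemma self_adjoint_eigenbasis_subspace:
  fixes f :: "'a::euclidean_space \<Rightarrow> 'a"
  assumes f: "linear f" and sa: "\<And>x y. f x \<bullet> y = x \<bullet> f y"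
    and "subspace S" and "f ` S \<subseteq> S"
  shows "\<exists>Q. pairwise orthogonal Q \<and> (\<forall>q\<in>Q. norm q = 1 \<and> (\<exists>m. f q = m *\<^sub>R q)) \<and> span Q = S"
  using assms(3,4)
proof (induction "dim S" arbitrary: S rule: less_induct)
  case less
  show ?case
  proof (cases "S = {0}")
    case True
    then show ?thesis by (intro exI[of _ "{}"]) simp
  next
    case False
    then obtain v l where v: "v \<in> S" "norm v = 1" "f v = l *\<^sub>R v"
      using self_adjoint_top_eigenvector[OF f sa less.prems] by blast
    define S' where "S' = {x \<in> S. x \<bullet> v = 0}"
    have sub: "subspace S'"
      using less.prems(1) unfolding S'_def subspace_def by (auto simp: inner_add_left)
    have inv: "f ` S' \<subseteq> S'"
      using less.prems(2) unfolding S'_def by (auto simp: sa v)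
    have "S' \<subset> S" using v unfolding S'_def by (force simp: dot_square_norm)
    then have "dim S' < dim S"
      using dim_psubset[of S' S] sub less.prems(1) by (metis span_eq_iff)
    from less.hyps[OF this sub inv] obtain Q where
      Q: "pairwise orthogonal Q" "\<forall>q\<in>Q. norm q = 1 \<and> (\<exists>m. f q = m *\<^sub>R q)" "span Q = S'" by blast
    have QS: "q \<in> S'" if "q \<in> Q" for q using Q(3) that span_base by blast
    have "span (insert v Q) = S"
    proof
      show "span (insert v Q) \<subseteq> S"
        using QS v less.prems(1) by (intro span_minimal) (auto simp: S'_def)
      show "S \<subseteq> span (insert v Q)"
      proof
        fix x assume x: "x \<in> S"
        have "x - (x \<bullet> v) *\<^sub>R v \<in> S'"
          using x v less.prems(1)
          by (auto simp: S'_def inner_diff_left dot_square_norm intro!: subspace_diff subspace_scale)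
        then show "x \<in> span (insert v Q)" unfolding span_insert Q(3) by blast
      qed
    qed
    moreover have "pairwise orthogonal (insert v Q)"
      using Q(1) QS by (auto simp: pairwise_insert orthogonal_def S'_def inner_commute)
    ultimately show ?thesis using Q(2) v by (intro exI[of _ "insert v Q"]) auto
  qed
qed

lemma orthonormal_parseval:
  fixes B :: "'a::euclidean_space set"
  assumes "pairwise orthogonal B" "\<And>b. b \<in> B \<Longrightarrow> norm b = 1" "span B = UNIV"
  shows "finite B" and "(\<Sum>b\<in>B. (x \<bullet> b) *\<^sub>R b) = x"
    and "(\<Sum>b\<in>B. (x \<bullet> b) * (y \<bullet> b)) = x \<bullet> y" and "(\<Sum>b\<in>B. (x \<bullet> b)\<^sup>2) = (norm x)\<^sup>2"
    and "card B = DIM('a)"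
proof -
  have ind: "independent B"
    using assms(1,2) by (intro pairwise_orthogonal_independent) force+
  then show fin: "finite B" by (rule finiteI_independent)
  show "card B = DIM('a)" using ind assms(3) by (metis dim_UNIV indep_card_eq_dim_span)
  have *: "x = (\<Sum>b\<in>B. (x \<bullet> b) *\<^sub>R b)" for x
  proof -
    have "orthogonal (x - (\<Sum>b\<in>B. (x \<bullet> b) *\<^sub>R b)) c" if "c \<in> B" for c
    proof -
      have "(\<Sum>b\<in>B. (x \<bullet> b) * (b \<bullet> c)) = (\<Sum>b\<in>B. if b = c then x \<bullet> c else 0)"
        using assms that
        by (intro sum.cong) (auto simp: pairwise_def orthogonal_def dot_square_norm)
      then show ?thesis
        using that fin by (simp add: orthogonal_def inner_diff_left inner_sum_left)
    qed
    then have "orthogonal (x - (\<Sum>b\<in>B. (x \<bullet> b) *\<^sub>R b)) (x - (\<Sum>b\<in>B. (x \<bullet> b) *\<^sub>R b))"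
      using orthogonal_to_span[of _ B] assms(3) by blast
    then show ?thesis by (simp add: orthogonal_def)
  qed
  then show "(\<Sum>b\<in>B. (x \<bullet> b) *\<^sub>R b) = x" by simp
  show p: "(\<Sum>b\<in>B. (x \<bullet> b) * (y \<bullet> b)) = x \<bullet> y" for x y
    using arg_cong[OF *[of y], of "inner x"] by (simp add: inner_sum_right mult.commute)
  show "(\<Sum>b\<in>B. (x \<bullet> b)\<^sup>2) = (norm x)\<^sup>2"
    using p[of x x] by (simp add: power2_eq_square dot_square_norm[unfolded power2_eq_square])
qed

text \<open>Conjugating t I - M by the orthogonal matrix whose rows are the eigenvectors factorises
  the characteristic polynomial. So the choice made in \<open>eigvals\<close> has a candidate, and
  one that comes with an eigenbasis.\<close>

lemma symmetric_matrix_spectrum: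
  fixes M :: "real^'n^'n::finite"
  assumes sym: "transpose M = M"
  obtains q :: "'n \<Rightarrow> real^'n" and l :: "real^'n"
  where "inj q" "pairwise orthogonal (range q)" "\<And>i. norm (q i) = 1" "span (range q) = UNIV"
    "\<And>i. M *v q i = (l $ i) *\<^sub>R q i" "is_spectrum M l"
proof -
  have sa: "(M *v x) \<bullet> y = x \<bullet> (M *v y)" for x y
    using sym by (metis dot_lmul_matrix transpose_matrix_vector)
  obtain Q where Q: "pairwise orthogonal Q" "\<forall>q\<in>Q. norm q = 1 \<and> (\<exists>m. M *v q = m *\<^sub>R q)" "span Q = UNIV"
    using self_adjoint_eigenbasis_subspace[OF matrix_vector_mul_linear sa subspace_UNIV] by auto
  have "finite Q" "card Q = CARD('n)" using orthonormal_parseval[of Q] Q by auto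
  then obtain q where "bij_betw q (UNIV::'n set) Q"
    by (metis finite_class.finite_UNIV finite_same_card_bij)
  then have q: "inj q" "range q = Q" by (auto simp: bij_betw_def)
  have "\<forall>i. \<exists>m. M *v q i = m *\<^sub>R q i" using Q(2) q(2) by blast
  then obtain L where L: "\<And>i. M *v q i = L i *\<^sub>R q i" by metis
  define l where "l = (\<chi> i. L i)"
  define P where "P = (\<chi> i. q i)"
  have ip: "q i \<bullet> q j = (if i = j then 1 else 0)" for i j
  proof (cases "i = j")
    case True
    have "norm (q j) = 1" using Q(2) q(2) by blast
    then show ?thesis using True by (simp add: dot_square_norm)
  next
    case False
    then have "q i \<noteq> q j" using q(1) by (auto dest: injD)
    then show ?thesis using Q(1) q(2) False by (auto simp: pairwise_def orthogonal_def)
  qed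
  have PPt: "P ** transpose P = mat 1"
    unfolding P_def matrix_matrix_mult_def transpose_def mat_def
    using ip by (simp add: vec_eq_iff inner_vec_def)
  have key: "P ** (t *\<^sub>R mat 1 - M) ** transpose P = (\<chi> i j. if i = j then t - L i else 0)" for t
  proof -
    have e1: "(P ** N ** transpose P) $ i $ j = q i \<bullet> (N *v q j)" for N :: "real^'n^'n" and i j
    proof -
      have "(P ** N ** transpose P) $ i $ j = (P ** (N ** transpose P)) $ i $ j"
        by (simp add: matrix_mul_assoc)
      also have "\<dots> = (\<Sum>k\<in>UNIV. q i $ k * (N ** transpose P) $ k $ j)"
        by (simp add: matrix_matrix_mult_def P_def)
      also have "\<dots> = q i \<bullet> (N *v q j)"
        by (simp add: inner_vec_def matrix_matrix_mult_def matrix_vector_mult_def transpose_def P_def)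
      finally show ?thesis .
    qed
    have e2: "(t *\<^sub>R mat 1 - M) *v q j = (t - L j) *\<^sub>R q j" for j
      by (simp add: matrix_vector_mult_diff_rdistrib L scaleR_matrix_vector_assoc[symmetric] scaleR_diff_left)
    show ?thesis by (subst vec_eq_iff, subst vec_eq_iff) (simp add: e1 e2 ip)
  qed
  have "det (t *\<^sub>R mat 1 - M) = (\<Prod>i\<in>UNIV. t - l $ i)" for t
  proof -
    have a: "det P * det (transpose P) = 1" using arg_cong[OF PPt, of det] by (simp add: det_mul)
    have b: "det P * det (t *\<^sub>R mat 1 - M) * det (transpose P) = (\<Prod>i\<in>UNIV. t - L i)"
      using arg_cong[OF key[of t], of det] by (subst (asm) det_diagonal) (auto simp: det_mul)
    have "det (t *\<^sub>R mat 1 - M) = (det P * det (transpose P)) * det (t *\<^sub>R mat 1 - M)"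
      unfolding a by simp
    also have "\<dots> = (\<Prod>i\<in>UNIV. t - L i)" unfolding b[symmetric] by (simp only: ac_simps)
    finally show ?thesis by (simp add: l_def)
  qed
  then have "is_spectrum M l" by (simp add: is_spectrum_def)
  moreover have "norm (q i) = 1" for i using Q(2) q(2) by blast
  ultimately show thesis using that[of q l] Q q L by (simp add: l_def)
qed

text \<open>The characteristic polynomial determines its roots as a multiset. Hence power sums at
  the unspecified choice \<open>eigvals M\<close> may be computed from the spectrum attached to an
  eigenbasis.\<close>

lemma is_spectrum_sum:
  fixes M :: "real^'n^'n::finite"
  assumes "is_spectrum M l" "is_spectrum M m"
  shows "(\<Sum>i\<in>UNIV. f (l $ i)) = (\<Sum>i\<in>UNIV. f (m $ i) :: real)"
proof -
  have pol: "poly (\<Prod>i\<in>UNIV. [:- l $ i, 1:]) t = (\<Prod>i\<in>UNIV. t - l $ i)" for l :: "real^'n" and t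
    by (simp add: poly_prod)
  have "(\<Prod>i\<in>UNIV. [:- l $ i, 1:]) = (\<Prod>i\<in>UNIV. [:- m $ i, 1:])"
    using assms by (intro poly_ext) (simp add: pol is_spectrum_def)
  then have "proots (\<Prod>i\<in>UNIV. [:- l $ i, 1:]) = proots (\<Prod>i\<in>UNIV. [:- m $ i, 1:])" by simp
  then have "(\<Sum>i\<in>UNIV. {#l $ i#}) = (\<Sum>i\<in>UNIV. {#m $ i#})"
    by (subst (asm) (1 2) proots_prod) auto
  then have "sum_mset (image_mset f (\<Sum>i\<in>UNIV. {#l $ i#})) = sum_mset (image_mset f (\<Sum>i\<in>UNIV. {#m $ i#}))"
    by simp
  moreover have "sum_mset (image_mset f (\<Sum>i\<in>A. {#l $ i#})) = (\<Sum>i\<in>A. f (l $ i))"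
    if "finite A" for l :: "real^'n" and A using that by induction auto
  ultimately show ?thesis by simp
qed

lemma sigma_one: "sigma 1 l = (\<Sum>i\<in>UNIV. l $ i)" for l :: "real^'n::finite"
proof -
  have "{S::'n set. card S = 1} = (\<lambda>i. {i}) ` UNIV" by (auto simp: card_1_singleton_iff)
  then show ?thesis unfolding sigma_def by (simp add: sum.reindex)
qed

text \<open>The square of the sum runs over ordered pairs: the diagonal ones give the squares, and
  each two-element set accounts for two of the others.\<close>

lemma sigma_two: "2 * sigma 2 l = (\<Sum>i\<in>UNIV. l $ i)\<^sup>2 - (\<Sum>i\<in>UNIV. (l $ i)\<^sup>2)" for l :: "real^'n::finite"
proof -
  let ?D = "{p::'n\<times>'n. fst p \<noteq> snd p}"
  have "(\<Sum>i\<in>UNIV. l $ i)\<^sup>2 = (\<Sum>p\<in>UNIV. l $ fst p * l $ snd p)"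
    by (simp add: power2_eq_square sum_product sum.cartesian_product UNIV_Times_UNIV[symmetric]
        case_prod_beta del: UNIV_Times_UNIV)
  also have "\<dots> = (\<Sum>p\<in>?D. l $ fst p * l $ snd p) + (\<Sum>p\<in>-?D. l $ fst p * l $ snd p)"
    by (subst sum.union_disjoint[symmetric]) (auto intro: sum.cong)
  also have "(\<Sum>p\<in>-?D. l $ fst p * l $ snd p) = (\<Sum>i\<in>UNIV. (l $ i)\<^sup>2)"
    by (rule sum.reindex_bij_witness[of _ "\<lambda>i. (i,i)" fst]) (auto simp: power2_eq_square)
  also have "(\<Sum>p\<in>?D. l $ fst p * l $ snd p)
      = (\<Sum>S\<in>{S. card S = 2}. \<Sum>p\<in>{p\<in>?D. {fst p, snd p} = S}. l $ fst p * l $ snd p)"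
    by (rule sum.group[symmetric]) auto
  also have "\<dots> = (\<Sum>S\<in>{S. card S = 2}. 2 * (\<Prod>i\<in>S. l $ i))"
  proof (rule sum.cong[OF refl])
    fix S :: "'n set" assume "S \<in> {S. card S = 2}"
    then obtain a b where ab: "S = {a,b}" "a \<noteq> b" by (auto simp: card_2_iff)
    then have "{p\<in>?D. {fst p, snd p} = S} = {(a,b),(b,a)}" by (auto simp: doubleton_eq_iff)
    then show "(\<Sum>p\<in>{p\<in>?D. {fst p, snd p} = S}. l $ fst p * l $ snd p) = 2 * (\<Prod>i\<in>S. l $ i)"
      using ab by simp
  qed
  finally show ?thesis by (simp add: sigma_def sum_distrib_left)
qed

text \<open>Positivity of \<sigma>_2 says that the sum of the squared eigenvalues is below the
  square of the trace, so each eigenvalue is below the trace, which is positive by \<sigma>_1. The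
  number \<open>(M *v e) \<bullet> e\<close> is an average of eigenvalues with weights
  \<open>(e \<bullet> q i)\<^sup>2\<close>, hence also below the trace; what remains of the trace is
  the sum over B.\<close>

lemma Gamma_cone_partial_trace_pos:
  fixes M :: "real^'n^'n::finite"
  assumes sym: "transpose M = M" and G: "eigvals M \<in> Gamma_cone k" and k: "2 \<le> k"
    and B: "pairwise orthogonal (insert e B)" "\<And>b. b \<in> insert e B \<Longrightarrow> norm b = 1"
      "span (insert e B) = UNIV" "e \<notin> B"
  shows "(\<Sum>b\<in>B. (M *v b) \<bullet> b) > 0"
proof -
  obtain q l where q: "inj q" "pairwise orthogonal (range q)" "\<And>i. norm (q i) = 1" "span (range q) = UNIV"
    and eig: "\<And>i. M *v q i = (l $ i) *\<^sub>R q i" and spec: "is_spectrum M l"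
    using symmetric_matrix_spectrum[OF sym] by metis
  have "is_spectrum M (eigvals M)" unfolding eigvals_def using spec by (rule someI)
  note sums = is_spectrum_sum[OF this spec]
  have "sigma 1 (eigvals M) > 0" "sigma 2 (eigvals M) > 0"
    using G k by (auto simp: Gamma_cone_def)
  then have s1: "(\<Sum>i\<in>UNIV. l $ i) > 0" and s2: "(\<Sum>i\<in>UNIV. l $ i)\<^sup>2 > (\<Sum>i\<in>UNIV. (l $ i)\<^sup>2)"
    using sigma_two[of "eigvals M"] sums[of "\<lambda>x. x"] sums[of "\<lambda>x. x\<^sup>2"] by (auto simp: sigma_one[simplified])
  have less: "l $ i < (\<Sum>i\<in>UNIV. l $ i)" for i
  proof (rule power2_less_imp_less)
    have "(l $ i)\<^sup>2 \<le> (\<Sum>i\<in>UNIV. (l $ i)\<^sup>2)" by (rule member_le_sum) auto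
    then show "(l $ i)\<^sup>2 < (\<Sum>i\<in>UNIV. l $ i)\<^sup>2" using s2 by simp
  qed (use s1 in simp)
  have quad: "(M *v x) \<bullet> x = (\<Sum>i\<in>UNIV. l $ i * (x \<bullet> q i)\<^sup>2)" for x
  proof -
    have 1: "(\<Sum>i\<in>UNIV. (x \<bullet> q i) * (y \<bullet> q i)) = x \<bullet> y" for x y
      using orthonormal_parseval(3)[OF q(2), of x y] q by (auto simp: sum.reindex)
    have "(M *v x) \<bullet> q i = l $ i * (x \<bullet> q i)" for i
      using sym by (metis dot_lmul_matrix eig inner_scaleR_right transpose_matrix_vector)
    then show ?thesis using 1[of "M *v x" x] by (simp add: power2_eq_square mult.assoc)
  qed
  have fB: "finite B" and par: "(\<Sum>b\<in>insert e B. (x \<bullet> b)\<^sup>2) = (norm x)\<^sup>2" for x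
    using orthonormal_parseval(1,4)[OF B(1,2,3)] by auto
  have "(\<Sum>b\<in>insert e B. (M *v b) \<bullet> b) = (\<Sum>i\<in>UNIV. l $ i * (\<Sum>b\<in>insert e B. (q i \<bullet> b)\<^sup>2))"
    unfolding quad sum_distrib_left by (subst sum.swap) (simp add: inner_commute)
  also have "\<dots> = (\<Sum>i\<in>UNIV. l $ i)" unfolding par q by simp
  finally have tr: "(M *v e) \<bullet> e + (\<Sum>b\<in>B. (M *v b) \<bullet> b) = (\<Sum>i\<in>UNIV. l $ i)"
    using fB B(4) by simp
  have one: "(\<Sum>i\<in>UNIV. (e \<bullet> q i)\<^sup>2) = 1"
    using orthonormal_parseval(4)[OF q(2), of e] q B(2)[of e] by (auto simp: sum.reindex)
  have "(M *v e) \<bullet> e < (\<Sum>i\<in>UNIV. (\<Sum>i\<in>UNIV. l $ i) * (e \<bullet> q i)\<^sup>2)"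
    unfolding quad
  proof (rule sum_strict_mono_ex1)
    show "\<exists>i\<in>UNIV. l $ i * (e \<bullet> q i)\<^sup>2 < (\<Sum>i\<in>UNIV. l $ i) * (e \<bullet> q i)\<^sup>2"
    proof -
      obtain i where "e \<bullet> q i \<noteq> 0" using one by fastforce
      then show ?thesis using less[of i] by (intro bexI[of _ i]) auto
    qed
  qed (use less in \<open>auto intro!: mult_right_mono[OF less_imp_le]\<close>)
  also have "\<dots> = (\<Sum>i\<in>UNIV. l $ i)" using one by (simp add: sum_distrib_left[symmetric])
  finally show ?thesis using tr by simp
qed

section \<open>Second order calculus and the conformal Hessian\<close>

text \<open>Gradient and Hessian are explicit functions here, so the Hessian of a composite is found
  by rewriting. Symmetry of the Hessian is carried along, which avoids Schwarz's theorem, and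
  continuity is asked for each fixed direction, which is what the second partial derivatives
  need.\<close>

definition C2_data :: "'a::euclidean_space set \<Rightarrow> ('a \<Rightarrow> real) \<Rightarrow> ('a \<Rightarrow> 'a) \<Rightarrow> ('a \<Rightarrow> 'a \<Rightarrow> 'a) \<Rightarrow> bool" where
  "C2_data U f g H \<longleftrightarrow> open U \<and>
     (\<forall>x\<in>U. (f has_derivative (\<lambda>v. g x \<bullet> v)) (at x) \<and> (g has_derivative H x) (at x) \<and>
        (\<forall>v w. H x v \<bullet> w = v \<bullet> H x w)) \<and>
     (\<forall>v. continuous_on U (\<lambda>x. H x v))"

lemma C2_dataD:
  assumes "C2_data U f g H"
  shows "open U" "x \<in> U \<Longrightarrow> (f has_derivative (\<lambda>v. g x \<bullet> v)) (at x)"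
    "x \<in> U \<Longrightarrow> (g has_derivative H x) (at x)" "x \<in> U \<Longrightarrow> H x v \<bullet> w = v \<bullet> H x w"
    "continuous_on U (\<lambda>x. H x v)" "continuous_on U f" "continuous_on U g"
proof -
  show "continuous_on U f" "continuous_on U g"
    using assms unfolding C2_data_def
    by (meson continuous_at_imp_continuous_on has_derivative_continuous)+
qed (use assms in \<open>auto simp: C2_data_def\<close>)

lemma C2_data_subset:
  assumes "C2_data U f g H" "open W" "W \<subseteq> U"
  shows "C2_data W f g H"
  using assms unfolding C2_data_def by (meson continuous_on_subset subsetD)

lemma C2_data_const: "C2_data UNIV (\<lambda>_. c) (\<lambda>_. 0) (\<lambda>_ _. 0)"
  unfolding C2_data_def
  by (auto intro!: has_derivative_eq_rhs[OF has_derivative_const] simp: fun_eq_iff)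

lemma C2_data_inner: "C2_data UNIV (\<lambda>x. a \<bullet> x) (\<lambda>_. a) (\<lambda>_ _. 0)"
  unfolding C2_data_def by (auto intro!: derivative_eq_intros)

lemma C2_data_add:
  assumes "C2_data U f g H" "C2_data U f' g' H'"
  shows "C2_data U (\<lambda>x. f x + f' x) (\<lambda>x. g x + g' x) (\<lambda>x v. H x v + H' x v)"
  using assms unfolding C2_data_def
  by (auto intro!: derivative_eq_intros continuous_intros simp: inner_add_left inner_add_right)

lemma C2_data_mult:
  assumes f: "C2_data U f g H" and f': "C2_data U f' g' H'"
  shows "C2_data U (\<lambda>x. f x * f' x) (\<lambda>x. f x *\<^sub>R g' x + f' x *\<^sub>R g x)
    (\<lambda>x v. f x *\<^sub>R H' x v + f' x *\<^sub>R H x v + (g x \<bullet> v) *\<^sub>R g' x + (g' x \<bullet> v) *\<^sub>R g x)"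
  unfolding C2_data_def
proof (intro conjI ballI allI)
  fix x assume x: "x \<in> U"
  show "((\<lambda>x. f x * f' x) has_derivative (\<lambda>v. (f x *\<^sub>R g' x + f' x *\<^sub>R g x) \<bullet> v)) (at x)"
    by (rule has_derivative_eq_rhs, rule has_derivative_mult[OF C2_dataD(2)[OF f x] C2_dataD(2)[OF f' x]])
       (auto simp: inner_add_left)
  show "((\<lambda>x. f x *\<^sub>R g' x + f' x *\<^sub>R g x) has_derivative
      (\<lambda>v. f x *\<^sub>R H' x v + f' x *\<^sub>R H x v + (g x \<bullet> v) *\<^sub>R g' x + (g' x \<bullet> v) *\<^sub>R g x)) (at x)"
    by (rule has_derivative_eq_rhs, rule has_derivative_add;
        (rule has_derivative_scaleR[OF C2_dataD(2)[OF f x] C2_dataD(3)[OF f' x]]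
          has_derivative_scaleR[OF C2_dataD(2)[OF f' x] C2_dataD(3)[OF f x]])?)
       (auto simp: algebra_simps)
  show "(f x *\<^sub>R H' x v + f' x *\<^sub>R H x v + (g x \<bullet> v) *\<^sub>R g' x + (g' x \<bullet> v) *\<^sub>R g x) \<bullet> w =
        v \<bullet> (f x *\<^sub>R H' x w + f' x *\<^sub>R H x w + (g x \<bullet> w) *\<^sub>R g' x + (g' x \<bullet> w) *\<^sub>R g x)" for v w
    using C2_dataD(4)[OF f x, of v w] C2_dataD(4)[OF f' x, of v w]
    by (simp add: inner_add_left inner_add_right inner_commute[of v "g x"] inner_commute[of v "g' x"] mult.commute)
next
  show "continuous_on U (\<lambda>x. f x *\<^sub>R H' x v + f' x *\<^sub>R H x v + (g x \<bullet> v) *\<^sub>R g' x + (g' x \<bullet> v) *\<^sub>R g x)" for v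
    by (intro continuous_intros C2_dataD(5,6,7)[OF f] C2_dataD(5,6,7)[OF f'])
qed (use f in \<open>auto simp: C2_data_def\<close>)

lemma C2_data_compose:
  assumes f: "C2_data U f g H"
    and F: "\<And>x. x \<in> U \<Longrightarrow> (F has_real_derivative F' (f x)) (at (f x))"
    and F': "\<And>x. x \<in> U \<Longrightarrow> (F' has_real_derivative F'' (f x)) (at (f x))"
    and F'': "continuous_on (f ` U) F''"
  shows "C2_data U (\<lambda>x. F (f x)) (\<lambda>x. F' (f x) *\<^sub>R g x)
    (\<lambda>x v. F' (f x) *\<^sub>R H x v + (F'' (f x) * (g x \<bullet> v)) *\<^sub>R g x)"
  unfolding C2_data_def
proof (intro conjI ballI allI)
  fix x assume x: "x \<in> U"
  note D = has_derivative_compose[OF C2_dataD(2)[OF f x]]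
  show "((\<lambda>x. F (f x)) has_derivative (\<lambda>v. (F' (f x) *\<^sub>R g x) \<bullet> v)) (at x)"
    by (rule has_derivative_eq_rhs, rule D[OF F[OF x, unfolded has_field_derivative_def]]) auto
  have "((\<lambda>x. F' (f x)) has_derivative (\<lambda>v. F'' (f x) * (g x \<bullet> v))) (at x)"
    by (rule D[OF F'[OF x, unfolded has_field_derivative_def]])
  from has_derivative_scaleR[OF this C2_dataD(3)[OF f x]]
  show "((\<lambda>x. F' (f x) *\<^sub>R g x) has_derivative
      (\<lambda>v. F' (f x) *\<^sub>R H x v + (F'' (f x) * (g x \<bullet> v)) *\<^sub>R g x)) (at x)" .
  show "(F' (f x) *\<^sub>R H x v + (F'' (f x) * (g x \<bullet> v)) *\<^sub>R g x) \<bullet> w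
      = v \<bullet> (F' (f x) *\<^sub>R H x w + (F'' (f x) * (g x \<bullet> w)) *\<^sub>R g x)" for v w
    using C2_dataD(4)[OF f x, of v w] by (simp add: inner_add_left inner_add_right inner_commute[of v "g x"])
next
  have "continuous_on (f ` U) F'"
    using F' by (intro continuous_at_imp_continuous_on) (auto intro: DERIV_isCont)
  then have "continuous_on U (\<lambda>x. F' (f x))" "continuous_on U (\<lambda>x. F'' (f x))"
    using F'' C2_dataD(6)[OF f] by (auto intro: continuous_on_compose2)
  then show "continuous_on U (\<lambda>x. F' (f x) *\<^sub>R H x v + (F'' (f x) * (g x \<bullet> v)) *\<^sub>R g x)" for v
    by (intro continuous_intros C2_dataD(5,6,7)[OF f])
qed (use f in \<open>auto simp: C2_data_def\<close>)

lemma C2_data_norm_sq: "C2_data UNIV (\<lambda>x. (norm x)\<^sup>2) (\<lambda>x. 2 *\<^sub>R x) (\<lambda>x v. 2 *\<^sub>R v)"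
proof -
  have "((\<lambda>x. (norm x)\<^sup>2) has_derivative (\<lambda>v. (2 *\<^sub>R x) \<bullet> v)) (at x)" for x :: 'a
    unfolding power2_norm_eq_inner by (rule has_derivative_eq_rhs) (auto intro!: derivative_eq_intros simp: inner_commute)
  then show ?thesis unfolding C2_data_def by (auto intro!: derivative_eq_intros)
qed

section \<open>Passage from gradient and Hessian fields to partial derivatives\<close>

lemma partial_deriv_C2_data:
  assumes "C2_data U f g H" "x \<in> U"
  shows "partial_deriv i f x = g x $ i"
  unfolding partial_deriv_def frechet_derivative_at[OF C2_dataD(2)[OF assms], symmetric]
  by (simp add: inner_axis)

lemma partial_deriv2_C2_data:
  fixes f :: "real^'n::finite \<Rightarrow> real"
  assumes f: "C2_data U f g H" and x: "x \<in> U"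
  shows "(partial_deriv j f has_derivative (\<lambda>v. H x v $ j)) (at x)"
    and "partial_deriv i (partial_deriv j f) x = H x (axis i 1) $ j"
proof -
  have "((\<lambda>y. g y $ j) has_derivative (\<lambda>v. H x v $ j)) (at x)"
    using bounded_linear.has_derivative[OF bounded_linear_vec_nth C2_dataD(3)[OF f x]] .
  then show *: "(partial_deriv j f has_derivative (\<lambda>v. H x v $ j)) (at x)"
    by (rule has_derivative_transform_within_open[OF _ C2_dataD(1)[OF f] x])
       (simp add: partial_deriv_C2_data[OF f])
  show "partial_deriv i (partial_deriv j f) x = H x (axis i 1) $ j"
    by (simp add: partial_deriv_def[of i] frechet_derivative_at[OF *, symmetric])
qed

lemma Ck_on_2_C2_data:
  fixes f :: "real^'n::finite \<Rightarrow> real"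
  assumes f: "C2_data U f g H"
  shows "Ck_on 2 U f"
proof -
  have "continuous_on U (partial_deriv i (partial_deriv j f))" for i j
  proof -
    have "continuous_on U (\<lambda>x. H x (axis i 1) $ j)"
      by (intro continuous_intros C2_dataD(5)[OF f])
    then show ?thesis by (simp add: partial_deriv2_C2_data(2)[OF f] cong: continuous_on_cong)
  qed
  moreover have "f differentiable at x" "partial_deriv j f differentiable at x" if "x \<in> U" for x j
    using C2_dataD(2)[OF f that] partial_deriv2_C2_data(1)[OF f that]
    by (auto simp: differentiable_def)
  ultimately show ?thesis by (simp add: numeral_2_eq_2)
qed

lemma grad_C2_data:
  "C2_data U f g H \<Longrightarrow> x \<in> U \<Longrightarrow> grad f x = g x"
  by (simp add: grad_def partial_deriv_C2_data vec_eq_iff)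

lemma hessian_C2_data:
  fixes f :: "real^'n::finite \<Rightarrow> real"
  assumes f: "C2_data U f g H" and x: "x \<in> U"
  shows "transpose (hessian f x) = hessian f x" and "hessian f x *v v = H x v"
proof -
  have lin: "linear (H x)" using C2_dataD(3)[OF f x] by (rule has_derivative_linear)
  have h: "hessian f x $ i $ j = H x (axis i 1) \<bullet> axis j 1" for i j
    by (simp add: hessian_def partial_deriv2_C2_data(2)[OF f x] inner_axis)
  have "hessian f x $ j $ i = hessian f x $ i $ j" for i j
    using C2_dataD(4)[OF f x, of "axis j 1" "axis i 1"] by (simp add: h inner_commute)
  then show s: "transpose (hessian f x) = hessian f x" by (simp add: vec_eq_iff transpose_def)
  have "(hessian f x *v v) $ i = H x v $ i" for i
  proof -
    have "(hessian f x *v v) $ i = (\<Sum>j\<in>UNIV. (H x (axis i 1) $ j) * v $ j)"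
      by (simp add: matrix_vector_mult_def h inner_axis)
    also have "\<dots> = H x (axis i 1) \<bullet> v" by (simp add: inner_vec_def)
    also have "\<dots> = H x v $ i" by (simp add: C2_dataD(4)[OF f x] inner_axis inner_commute[of "axis i 1"])
    finally show ?thesis .
  qed
  then show "hessian f x *v v = H x v" by (simp add: vec_eq_iff)
qed

text \<open>The metric u^(4/(n-2)) |dx|^2 becomes e^(2 \<omega>) |dx|^2. Its Schouten tensor is the
  negative of the bracket in the last formula, and the factor e^(-2 \<omega>) raises an
  index.\<close>

lemma conformal_hessian_exp:
  fixes \<omega> :: "real^'n::finite \<Rightarrow> real"
  assumes n: "CARD('n) \<ge> 3" and om: "C2_data U \<omega> g H" and x: "x \<in> U"
  defines "\<phi> \<equiv> \<lambda>x. exp ((real CARD('n) - 2) / 2 * \<omega> x)"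
  shows "Ck_on 2 U \<phi>"
    and "transpose (- conformal_hessian \<phi> x) = - conformal_hessian \<phi> x"
    and "(- conformal_hessian \<phi> x *v v) \<bullet> v
      = exp (- 2 * \<omega> x) * (H x v \<bullet> v - (g x \<bullet> v)\<^sup>2 + (norm (g x))\<^sup>2 * (norm v)\<^sup>2 / 2)"
proof -
  define m where "m = real CARD('n) - 2"
  define b where "b = m / 2"
  have m: "m > 0" using n by (simp add: m_def)
  have nm: "real CARD('n) = m + 2" by (simp add: m_def)
  have phi: "C2_data U \<phi> (\<lambda>x. (b * exp (b * \<omega> x)) *\<^sub>R g x)
      (\<lambda>x v. (b * exp (b * \<omega> x)) *\<^sub>R H x v + (b * (b * exp (b * \<omega> x)) * (g x \<bullet> v)) *\<^sub>R g x)"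
    unfolding \<phi>_def b_def m_def
    by (rule C2_data_compose[OF om, where F = "\<lambda>s. exp ((real CARD('n) - 2) / 2 * s)"
          and F' = "\<lambda>s. (real CARD('n) - 2) / 2 * exp ((real CARD('n) - 2) / 2 * s)"
          and F'' = "\<lambda>s. (real CARD('n) - 2) / 2 * ((real CARD('n) - 2) / 2 * exp ((real CARD('n) - 2) / 2 * s))"])
      (auto intro!: derivative_eq_intros continuous_intros)
  show "Ck_on 2 U \<phi>" by (rule Ck_on_2_C2_data[OF phi])
  have tr: "transpose (outer w w) = outer w w" for w :: "real^'n"
    by (simp add: vec_eq_iff transpose_def outer_def mult.commute)
  have t1: "transpose (mat 1 :: real^'n^'n) = mat 1" by (rule transpose_mat)
  show "transpose (- conformal_hessian \<phi> x) = - conformal_hessian \<phi> x"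
    using hessian_C2_data(1)[OF phi x] tr[of "grad \<phi> x"] t1
    unfolding conformal_hessian_def Let_def vec_eq_iff transpose_def by (simp add: vec_eq_iff)
  have ov: "outer w w *v v = (w \<bullet> v) *\<^sub>R w" for w :: "real^'n"
    by (simp add: vec_eq_iff outer_def matrix_vector_mult_def inner_vec_def sum_distrib_left sum_distrib_right ac_simps)
  have p: "\<phi> x powr a = exp (b * a * \<omega> x)" for a
    by (simp add: \<phi>_def powr_def b_def m_def)
  have neg: "(- M) *v v = - (M *v v)" for M :: "real^'n^'n"
    by (simp add: vec_eq_iff matrix_vector_mult_def sum_negf)
  \<comment> \<open>The value of \<phi> at x is E, and its two powers in the conformal Hessian are P
    / E and P / E^2. The Hessian contributes one factor E and the products of gradients two, so all
    of them cancel.\<close>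
  define P where "P = exp (- 2 * \<omega> x)"
  define E where "E = exp (b * \<omega> x)"
  have E0: "E > 0" by (simp add: E_def)
  have p1: "\<phi> x powr (- ((real CARD('n) + 2) / (real CARD('n) - 2))) = P / E"
  proof -
    have "b * - ((real CARD('n) + 2) / (real CARD('n) - 2)) = - 2 - b"
      using m by (simp add: nm b_def field_simps)
    then show ?thesis unfolding p P_def E_def by (simp only:) (simp add: exp_diff[symmetric] algebra_simps)
  qed
  have p2: "\<phi> x powr (- (2 * real CARD('n) / (real CARD('n) - 2))) = P / E\<^sup>2"
  proof -
    have "b * - (2 * real CARD('n) / (real CARD('n) - 2)) = - 2 - 2 * b"
      using m by (simp add: nm b_def field_simps)
    then show ?thesis unfolding p P_def E_def
      by (simp only:) (simp add: exp_diff[symmetric] exp_double[symmetric] algebra_simps)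
  qed
  have gr: "grad \<phi> x = (b * E) *\<^sub>R g x"
    using grad_C2_data[OF phi x] by (simp add: E_def)
  have he: "hessian \<phi> x *v v = (b * E) *\<^sub>R H x v + (b * (b * E) * (g x \<bullet> v)) *\<^sub>R g x"
    using hessian_C2_data(2)[OF phi x] by (simp add: E_def)
  have "(conformal_hessian \<phi> x *v v) \<bullet> v = - (2 / m * (P / E)) * ((hessian \<phi> x *v v) \<bullet> v)
     + (2 * (m + 2) / m\<^sup>2 * (P / E\<^sup>2)) * (grad \<phi> x \<bullet> v)\<^sup>2
     - (2 / m\<^sup>2 * (P / E\<^sup>2) * (norm (grad \<phi> x))\<^sup>2) * (norm v)\<^sup>2"
    unfolding conformal_hessian_def Let_def p1 p2
    by (simp add: nm matrix_vector_mult_add_rdistrib matrix_vector_mult_diff_rdistrib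
        scaleR_matrix_vector_assoc[symmetric] ov inner_add_left inner_diff_left
        power2_eq_square dot_square_norm[unfolded power2_eq_square])
  also have "\<dots> = - P * (H x v \<bullet> v - (g x \<bullet> v)\<^sup>2 + (norm (g x))\<^sup>2 * (norm v)\<^sup>2 / 2)"
    unfolding he gr using m E0
    by (simp add: inner_add_left b_def power2_eq_square field_simps)
  finally show "(- conformal_hessian \<phi> x *v v) \<bullet> v
      = exp (- 2 * \<omega> x) * (H x v \<bullet> v - (g x \<bullet> v)\<^sup>2 + (norm (g x))\<^sup>2 * (norm v)\<^sup>2 / 2)"
    using neg by (simp add: P_def minus_mult_left[symmetric])
qed

text \<open>The equation enters the argument here: the subsolution condition places the eigenvalues
  of the test function in the cone. The positive factor \<open>exp (- 2 * \<omega> x0)\<close> is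
  divided out, and each of the n - 1 unit vectors in B contributes half of the squared
  gradient.\<close>

lemma viscosity_subsolution_trace:
  fixes u \<omega> :: "real^'n::finite \<Rightarrow> real"
  assumes n: "CARD('n) \<ge> 3" and k: "2 \<le> k"
    and u: "viscosity_solution k \<Omega> u" and x0: "x0 \<in> \<Omega>"
    and om: "C2_data U \<omega> g H" and U: "x0 \<in> U"
    and eq: "u x0 = exp ((real CARD('n) - 2) / 2 * \<omega> x0)"
    and le: "\<forall>\<^sub>F x in nhds x0. u x \<le> exp ((real CARD('n) - 2) / 2 * \<omega> x)"
    and B: "pairwise orthogonal (insert e B)" "\<And>b. b \<in> insert e B \<Longrightarrow> norm b = 1"
      "span (insert e B) = UNIV" "e \<notin> B"
  shows "(\<Sum>b\<in>B. H x0 b \<bullet> b - (g x0 \<bullet> b)\<^sup>2) + (real CARD('n) - 1) / 2 * (norm (g x0))\<^sup>2 > 0"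
proof -
  let ?\<phi> = "\<lambda>x. exp ((real CARD('n) - 2) / 2 * \<omega> x)"
  note ch = conformal_hessian_exp[OF n om U]
  have "test_function_at u x0 ?\<phi>"
    unfolding test_function_at_def using C2_dataD(1)[OF om] U ch(1) eq by (auto intro!: exI[of _ U])
  then have "eigvals (- conformal_hessian ?\<phi> x0) \<in> Gamma_cone k"
    using u x0 le unfolding viscosity_solution_def by blast
  from Gamma_cone_partial_trace_pos[OF ch(2) this k B]
  have "0 < (\<Sum>b\<in>B. exp (- 2 * \<omega> x0) * (H x0 b \<bullet> b - (g x0 \<bullet> b)\<^sup>2 + (norm (g x0))\<^sup>2 * (norm b)\<^sup>2 / 2))"
    unfolding ch(3) .
  also have "\<dots> = exp (- 2 * \<omega> x0) * (\<Sum>b\<in>B. H x0 b \<bullet> b - (g x0 \<bullet> b)\<^sup>2 + (norm (g x0))\<^sup>2 / 2)"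
    using B(2) by (simp add: sum_distrib_left)
  finally have "0 < (\<Sum>b\<in>B. H x0 b \<bullet> b - (g x0 \<bullet> b)\<^sup>2 + (norm (g x0))\<^sup>2 / 2)"
    by (simp add: zero_less_mult_iff)
  moreover have "real (card B) = real CARD('n) - 1"
    using orthonormal_parseval(1,5)[OF B(1,2,3)] B(4) by simp
  moreover have "(\<Sum>b\<in>B. H x0 b \<bullet> b - (g x0 \<bullet> b)\<^sup>2 + (norm (g x0))\<^sup>2 / 2)
      = (\<Sum>b\<in>B. H x0 b \<bullet> b - (g x0 \<bullet> b)\<^sup>2) + real (card B) * ((norm (g x0))\<^sup>2 / 2)"
    by (simp add: sum.distrib)
  ultimately show ?thesis by simp
qed

section \<open>Polynomials and the partial Laplacian\<close>

text \<open>The images of a basis of the span are independent, so a vector outside their span would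
  give too many independent vectors. Linearity is assumed on the span only, because an operator
  built from \<open>frechet_derivative\<close> need not be additive on nondifferentiable
  functions.\<close>

lemma (in vector_space) injective_on_finite_span_surjective:
  assumes T: "finite T"
    and add: "\<And>x y. x \<in> span T \<Longrightarrow> y \<in> span T \<Longrightarrow> L (x + y) = L x + L y"
    and sc: "\<And>c x. x \<in> span T \<Longrightarrow> L (scale c x) = scale c (L x)"
    and L: "\<And>x. x \<in> span T \<Longrightarrow> L x \<in> span T"
    and ker: "\<And>x. x \<in> span T \<Longrightarrow> L x = 0 \<Longrightarrow> x = 0"
    and y: "y \<in> span T"
  shows "\<exists>x\<in>span T. L x = y"
proof -
  obtain S where S: "S \<subseteq> T" "independent S" "T \<subseteq> span S"
    using maximal_independent_subset[of T] by blast
  have sp: "span S = span T"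
    using S by (meson span_mono span_minimal subspace_span subset_antisym)
  have fin: "finite S" using S(1) T finite_subset by blast
  have L0: "L 0 = 0" using sc[of 0 0] by (simp add: span_zero)
  have Lsum: "L (\<Sum>t\<in>A. scale (c t) t) = (\<Sum>t\<in>A. scale (c t) (L t))" if "finite A" "A \<subseteq> S" for A c
    using that
  proof (induction A)
    case (insert a A)
    have "scale (c a) a \<in> span T" "(\<Sum>t\<in>A. scale (c t) t) \<in> span T" "a \<in> span T"
      using insert.prems sp by (auto intro!: span_sum span_scale intro: span_base)
    then show ?case using insert by (simp add: add sc)
  qed (simp add: L0)
  have inS: "(\<Sum>t\<in>S. scale (c t) t) \<in> span T" for c
    using sp by (auto intro!: span_sum span_scale intro: span_base)
  have inj: "inj_on L S"
  proof (rule inj_onI)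
    fix a b assume ab: "a \<in> S" "b \<in> S" "L a = L b"
    then have sab: "a \<in> span T" "b \<in> span T" using sp by (auto intro: span_base)
    then have nb: "scale (-1) b \<in> span T" by (intro span_scale)
    have "L (a + scale (-1) b) = 0"
      unfolding add[OF sab(1) nb] sc[OF sab(2)] using ab(3) by simp
    then have "a + scale (-1) b = 0" using ker sab nb by (meson span_add)
    then show "a = b" by simp
  qed
  have ind: "independent (L ` S)"
  proof
    assume "dependent (L ` S)"
    then obtain c where c: "\<exists>v\<in>L ` S. c v \<noteq> 0" "(\<Sum>v\<in>L ` S. scale (c v) v) = 0"
      using dependent_finite[of "L ` S"] fin by auto
    have "L (\<Sum>t\<in>S. scale (c (L t)) t) = 0"
      using c(2) Lsum[OF fin subset_refl, of "\<lambda>t. c (L t)"] by (simp add: sum.reindex[OF inj])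
    then have "(\<Sum>t\<in>S. scale (c (L t)) t) = 0" by (rule ker[OF inS])
    moreover obtain t where "t \<in> S" "c (L t) \<noteq> 0" using c(1) by blast
    ultimately have "dependent S"
      unfolding dependent_finite[OF fin] by (intro exI[of _ "\<lambda>t. c (L t)"]) blast
    then show False using S(2) by simp
  qed
  have sub: "L ` S \<subseteq> span S" using L sp by (auto intro: span_base)
  have "y \<in> span (L ` S)"
  proof (rule ccontr)
    assume y': "y \<notin> span (L ` S)"
    then have "independent (insert y (L ` S))" using ind by (rule independent_insertI)
    then have "card (insert y (L ` S)) \<le> card S"
      using independent_span_bound[OF fin, of "insert y (L ` S)"] sub y sp by auto
    moreover have "y \<notin> L ` S" using y' by (auto intro: span_base)
    ultimately show False using fin by (simp add: card_image[OF inj])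
  qed
  then obtain c where "y = (\<Sum>v\<in>L ` S. scale (c v) v)"
    using span_finite[of "L ` S"] fin by auto
  then have "y = L (\<Sum>t\<in>S. scale (c (L t)) t)"
    using Lsum[OF fin subset_refl, of "\<lambda>t. c (L t)"] by (simp add: sum.reindex[OF inj])
  then show ?thesis using inS[of "\<lambda>t. c (L t)"] by metis
qed

interpretation real_fun: vector_space "\<lambda>(c::real) (f::'a \<Rightarrow> real) x. c * f x"
  by unfold_locales (auto simp: fun_eq_iff algebra_simps)

text \<open>These are the polynomials in the coordinates \<open>b \<bullet> x\<close>, with m a
  bound on the degree and not the degree itself; so for fixed m they form a vector space. With B a
  basis of a hyperplane they ignore the normal component of x.\<close>

inductive poly_fun :: "'a::euclidean_space set \<Rightarrow> nat \<Rightarrow> ('a \<Rightarrow> real) \<Rightarrow> bool" for B where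
  const: "poly_fun B m (\<lambda>_. c)"
| add: "poly_fun B m f \<Longrightarrow> poly_fun B m g \<Longrightarrow> poly_fun B m (\<lambda>x. f x + g x)"
| mult: "b \<in> B \<Longrightarrow> poly_fun B m f \<Longrightarrow> poly_fun B (Suc m) (\<lambda>x. (b \<bullet> x) * f x)"

lemma poly_fun_Suc: "poly_fun B m f \<Longrightarrow> poly_fun B (Suc m) f"
  by (induction rule: poly_fun.induct) (auto intro: poly_fun.intros)

lemma poly_fun_mono: "poly_fun B m f \<Longrightarrow> m \<le> k \<Longrightarrow> poly_fun B k f"
  by (rule dec_induct[of m k]) (auto intro: poly_fun_Suc)

lemma poly_fun_scale: "poly_fun B m f \<Longrightarrow> poly_fun B m (\<lambda>x. c * f x)"
proof (induction rule: poly_fun.induct)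
  case (mult b m f)
  then have "poly_fun B (Suc m) (\<lambda>x. (b \<bullet> x) * (c * f x))" by (intro poly_fun.mult)
  then show ?case by (simp add: mult.left_commute)
qed (auto intro: poly_fun.intros simp: distrib_left)

lemma poly_fun_diff: "poly_fun B m f \<Longrightarrow> poly_fun B m g \<Longrightarrow> poly_fun B m (\<lambda>x. f x - g x)"
  using poly_fun.add[OF _ poly_fun_scale[of B m g "-1"]] by simp

lemma poly_fun_sum: "(\<And>i. i \<in> I \<Longrightarrow> poly_fun B m (f i)) \<Longrightarrow> poly_fun B m (\<lambda>x. \<Sum>i\<in>I. f i x)"
  by (induction I rule: infinite_finite_induct) (auto intro: poly_fun.intros)

lemma poly_fun_mult:
  "poly_fun B m f \<Longrightarrow> poly_fun B l g \<Longrightarrow> poly_fun B (m + l) (\<lambda>x. f x * g x)"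
proof (induction rule: poly_fun.induct)
  case (const m c)
  then show ?case by (intro poly_fun_scale) (auto intro: poly_fun_mono)
next
  case (add m f g')
  then have "poly_fun B (m + l) (\<lambda>x. f x * g x + g' x * g x)" by (intro poly_fun.add) auto
  then show ?case by (simp add: distrib_right)
next
  case (mult b m f)
  then have "poly_fun B (Suc (m + l)) (\<lambda>x. (b \<bullet> x) * (f x * g x))" by (intro poly_fun.mult) auto
  then show ?case by (simp add: mult.assoc)
qed

lemma poly_fun_inner: "b \<in> B \<Longrightarrow> poly_fun B 1 (\<lambda>x. b \<bullet> x)"
  using poly_fun.mult[OF _ poly_fun.const[of B 0 1], of b] by simp

lemma poly_fun_0: "poly_fun B m f \<Longrightarrow> m = 0 \<Longrightarrow> \<exists>c. f = (\<lambda>_. c)"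
  by (induction rule: poly_fun.induct) auto

lemma poly_fun_C2_data: "poly_fun B m f \<Longrightarrow> \<exists>g H. C2_data UNIV f g H"
proof (induction rule: poly_fun.induct)
  case (const m c) then show ?case using C2_data_const by blast
next
  case (add m f g) then show ?case using C2_data_add by blast
next
  case (mult b m f) then show ?case using C2_data_mult[OF C2_data_inner] by blast
qed

text \<open>Raising the degree bound by one adds only the products of the old generators with the
  finitely many coordinates. The finite dimension is what turns uniqueness for the Dirichlet problem
  into existence.\<close>

lemma poly_fun_finite_span:
  fixes B :: "'a::euclidean_space set"
  assumes "finite B"
  shows "\<exists>T. finite T \<and> real_fun.span T = {f. poly_fun B m f}"
proof -
  have sub: "real_fun.subspace {f. poly_fun B m f}" for m
    using poly_fun.const[of B m 0] poly_fun.add[of B m] poly_fun_scale[of B m]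
    unfolding real_fun.subspace_def zero_fun_def plus_fun_def by auto
  have "\<exists>T. finite T \<and> (\<forall>t\<in>T. poly_fun B m t) \<and> (\<forall>f. poly_fun B m f \<longrightarrow> f \<in> real_fun.span T)"
  proof (induction m)
    case 0
    have "f \<in> real_fun.span {\<lambda>_. 1}" if f0: "poly_fun B 0 f" for f
    proof -
      obtain c where "f = (\<lambda>_. c)" using poly_fun_0[OF f0 refl] by auto
      then have "f = (\<lambda>x. c * (\<lambda>_. 1) x)" by simp
      then show ?thesis using real_fun.span_scale[OF real_fun.span_base, of "\<lambda>_. 1" "{\<lambda>_. 1}" c] by simp
    qed
    then show ?case by (intro exI[of _ "{\<lambda>_. 1}"]) (auto intro: poly_fun.const)
  next
    case (Suc m)
    then obtain T where T: "finite T" "\<forall>t\<in>T. poly_fun B m t" "\<forall>f. poly_fun B m f \<longrightarrow> f \<in> real_fun.span T"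
      by blast
    define T' where "T' = T \<union> (\<lambda>(b, t) x. (b \<bullet> x) * t x) ` (B \<times> T)"
    have mult: "(\<lambda>x. (b \<bullet> x) * f x) \<in> real_fun.span T'" if b: "b \<in> B" and f: "f \<in> real_fun.span T" for b f
      using f
    proof (induction rule: real_fun.span_induct_alt)
      case base
      then show ?case using real_fun.span_zero[of T'] by (simp add: zero_fun_def)
    next
      case (step c t f)
      have "(\<lambda>x. (b \<bullet> x) * t x) \<in> T'" using step b unfolding T'_def by force
      then have "(\<lambda>x. c * ((b \<bullet> x) * t x)) + (\<lambda>x. (b \<bullet> x) * f x) \<in> real_fun.span T'"
        using step by (intro real_fun.span_add real_fun.span_scale) (auto intro: real_fun.span_base)
      then show ?case by (simp add: plus_fun_def algebra_simps)
    qed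
    have mono: "real_fun.span T \<subseteq> real_fun.span T'"
      by (rule real_fun.span_mono) (simp add: T'_def)
    have "f \<in> real_fun.span T'" if "poly_fun B (Suc m) f" for f
      using that
    proof (induction "Suc m" f rule: poly_fun.induct)
      case (const c)
      then show ?case using T(3) poly_fun.const mono by blast
    next
      case (add f g)
      then show ?case using real_fun.span_add[of f T' g] by (simp add: plus_fun_def)
    next
      case (mult b f)
      then show ?case using \<open>\<And>b f. b \<in> B \<Longrightarrow> f \<in> real_fun.span T \<Longrightarrow> (\<lambda>x. (b \<bullet> x) * f x) \<in> real_fun.span T'\<close> T(3)
        by blast
    qed
    moreover have "finite T'" using T(1) assms by (simp add: T'_def)
    moreover have "\<forall>t\<in>T'. poly_fun B (Suc m) t"
      using T(2) by (auto simp: T'_def intro: poly_fun_Suc poly_fun.mult)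
    ultimately show ?case by blast
  qed
  then obtain T where T: "finite T" "\<forall>t\<in>T. poly_fun B m t" "\<forall>f. poly_fun B m f \<longrightarrow> f \<in> real_fun.span T" by blast
  then have "real_fun.span T = {f. poly_fun B m f}"
    using real_fun.span_minimal[OF _ sub, of T m] by auto
  then show ?thesis using T(1) by blast
qed

section \<open>The partial Laplacian on polynomials\<close>

definition dderiv :: "'a::euclidean_space \<Rightarrow> ('a \<Rightarrow> real) \<Rightarrow> 'a \<Rightarrow> real" where
  "dderiv b f x = frechet_derivative f (at x) b"

definition partial_laplacian :: "'a::euclidean_space set \<Rightarrow> ('a \<Rightarrow> real) \<Rightarrow> 'a \<Rightarrow> real" where
  "partial_laplacian B f x = (\<Sum>b\<in>B. dderiv b (dderiv b f) x)"

lemma dderiv_eq: "(f has_derivative f') (at x) \<Longrightarrow> dderiv b f x = f' b"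
  unfolding dderiv_def by (simp add: frechet_derivative_at[symmetric])

lemma dderiv_C2_data:
  assumes "C2_data UNIV f g H"
  shows "dderiv b f = (\<lambda>x. g x \<bullet> b)" and "dderiv c (dderiv b f) x = H x c \<bullet> b"
proof -
  show *: "dderiv b f = (\<lambda>x. g x \<bullet> b)"
    using C2_dataD(2)[OF assms] by (auto simp: dderiv_eq)
  have "((\<lambda>x. g x \<bullet> b) has_derivative (\<lambda>v. H x v \<bullet> b)) (at x)"
    using C2_dataD(3)[OF assms, of x] by (auto intro!: derivative_eq_intros)
  then show "dderiv c (dderiv b f) x = H x c \<bullet> b" unfolding * by (rule dderiv_eq)
qed

lemma partial_laplacian_C2_data:
  "C2_data UNIV f g H \<Longrightarrow> partial_laplacian B f x = (\<Sum>b\<in>B. H x b \<bullet> b)"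
  by (simp add: partial_laplacian_def dderiv_C2_data(2))

text \<open>The second conjunct repairs the truncated subtraction: in the product rule the term
  \<open>(c \<bullet> x) * dderiv b f x\<close> has degree bound \<open>Suc (m - 1)\<close>, which
  exceeds m when m is 0, unless the derivative is known to vanish.\<close>

lemma poly_fun_dderiv:
  "poly_fun B m f \<Longrightarrow> poly_fun B (m - 1) (dderiv b f) \<and> (m = 0 \<longrightarrow> dderiv b f = (\<lambda>_. 0))"
proof (induction rule: poly_fun.induct)
  case (const m c)
  have "dderiv b (\<lambda>_. c) = (\<lambda>_. 0)" for c :: real
    by (rule ext, rule dderiv_eq[of _ "\<lambda>_. 0"]) simp
  then show ?case by (auto intro: poly_fun.const)
next
  case (add m f f')
  obtain g H g' H' where d: "C2_data UNIV f g H" "C2_data UNIV f' g' H'"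
    using add.hyps poly_fun_C2_data by metis
  have "dderiv b (\<lambda>x. f x + f' x) = (\<lambda>x. dderiv b f x + dderiv b f' x)"
    unfolding dderiv_C2_data(1)[OF C2_data_add[OF d]] dderiv_C2_data(1)[OF d(1)] dderiv_C2_data(1)[OF d(2)]
    by (simp add: inner_add_left)
  then show ?case using add.IH by (auto intro: poly_fun.add)
next
  case (mult c m f)
  obtain g H where d: "C2_data UNIV f g H" using mult.hyps poly_fun_C2_data by metis
  have *: "dderiv b (\<lambda>x. (c \<bullet> x) * f x) = (\<lambda>x. (c \<bullet> x) * dderiv b f x + (c \<bullet> b) * f x)"
    unfolding dderiv_C2_data(1)[OF C2_data_mult[OF C2_data_inner d]] dderiv_C2_data(1)[OF d]
    by (simp add: inner_add_left mult.commute)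
  have "poly_fun B m (\<lambda>x. (c \<bullet> x) * dderiv b f x)"
  proof (cases m)
    case 0
    then show ?thesis using mult.IH by (simp add: poly_fun.const)
  next
    case (Suc m')
    then show ?thesis using mult.IH mult.hyps by (auto intro: poly_fun.mult)
  qed
  then show ?case using mult.hyps by (auto simp: * intro!: poly_fun.add poly_fun_scale)
qed

lemma poly_fun_partial_laplacian:
  assumes "poly_fun B (m + 2) f"
  shows "poly_fun B m (partial_laplacian B f)"
proof -
  have "poly_fun B m (dderiv b (dderiv b f))" for b
    using poly_fun_dderiv[of B "m + 1" "dderiv b f" b] poly_fun_dderiv[OF assms, of b] by simp
  then show ?thesis unfolding partial_laplacian_def[abs_def] by (intro poly_fun_sum)
qed

lemma partial_laplacian_add:
  assumes "C2_data UNIV f g H" "C2_data UNIV f' g' H'"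
  shows "partial_laplacian B (\<lambda>x. f x + f' x) x = partial_laplacian B f x + partial_laplacian B f' x"
  by (simp add: partial_laplacian_C2_data[OF C2_data_add[OF assms]] partial_laplacian_C2_data[OF assms(1)]
      partial_laplacian_C2_data[OF assms(2)] inner_add_left sum.distrib)

lemma C2_data_cmult:
  assumes "C2_data UNIV f g H"
  shows "C2_data UNIV (\<lambda>x. c * f x) (\<lambda>x. c *\<^sub>R g x) (\<lambda>x v. c *\<^sub>R H x v)"
  using C2_data_mult[OF C2_data_const[of c] assms] by simp

lemma partial_laplacian_cmult:
  assumes "C2_data UNIV f g H"
  shows "partial_laplacian B (\<lambda>x. c * f x) x = c * partial_laplacian B f x"
  by (simp add: partial_laplacian_C2_data[OF C2_data_cmult[OF assms]] partial_laplacian_C2_data[OF assms]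
      sum_distrib_left)

text \<open>Were the second derivative positive, the first one would be zero at y and positive just
  beyond, so f would increase. Only maximality along one line enters, which suits a maximum over a
  disc inside a hyperplane.\<close>

lemma second_derivative_local_max:
  assumes f: "C2_data UNIV f g H" and d: "d > 0"
    and mx: "\<And>s::real. \<bar>s\<bar> < d \<Longrightarrow> f (y + s *\<^sub>R b) \<le> f y"
  shows "H y b \<bullet> b \<le> 0"
proof (rule ccontr)
  assume "\<not> H y b \<bullet> b \<le> 0"
  then have pos: "H y b \<bullet> b > 0" by simp
  have line: "((\<lambda>s. y + s *\<^sub>R b) has_derivative (\<lambda>t. t *\<^sub>R b)) (at s)" for s :: real
    by (auto intro!: derivative_eq_intros)
  have d1: "((\<lambda>s. f (y + s *\<^sub>R b)) has_real_derivative g (y + s *\<^sub>R b) \<bullet> b) (at s)" for s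
    unfolding has_field_derivative_def
    by (rule has_derivative_eq_rhs, rule has_derivative_compose[OF line C2_dataD(2)[OF f UNIV_I]])
       (simp add: fun_eq_iff mult.commute)
  have lH: "linear (H y)" using C2_dataD(3)[OF f, of y] has_derivative_linear by blast
  have "((\<lambda>s. g (y + s *\<^sub>R b)) has_derivative (\<lambda>t. H (y + 0 *\<^sub>R b) (t *\<^sub>R b))) (at 0)"
    by (rule has_derivative_compose[OF line C2_dataD(3)[OF f UNIV_I]])
  then have "((\<lambda>s. g (y + s *\<^sub>R b) \<bullet> b) has_derivative (\<lambda>t. H (y + 0 *\<^sub>R b) (t *\<^sub>R b) \<bullet> b)) (at 0)"
    by (auto intro!: derivative_eq_intros)
  then have d2: "((\<lambda>s. g (y + s *\<^sub>R b) \<bullet> b) has_real_derivative H y b \<bullet> b) (at 0)"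
    unfolding has_field_derivative_def using lH
    by (auto simp: linear_cmul fun_eq_iff mult.commute elim!: has_derivative_eq_rhs)
  have z: "g y \<bullet> b = 0"
    using DERIV_local_max[OF d1[of 0] d] mx by auto
  obtain r where r: "r > 0" "\<And>s. 0 < s \<Longrightarrow> s < r \<Longrightarrow> g y \<bullet> b < g (y + s *\<^sub>R b) \<bullet> b"
    using DERIV_pos_inc_right[OF d2 pos] by auto
  define s where "s = min r d / 2"
  have s: "0 < s" "s < r" "s < d" using r(1) d by (auto simp: s_def)
  have "f (y + 0 *\<^sub>R b) < f (y + s *\<^sub>R b)"
  proof (rule DERIV_pos_imp_increasing_open[OF s(1)])
    fix t :: real assume "0 < t" "t < s"
    then show "\<exists>y'. ((\<lambda>s. f (y + s *\<^sub>R b)) has_real_derivative y') (at t) \<and> 0 < y'"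
      using d1[of t] r(2)[of t] s z by auto
  next
    show "continuous_on {0..s} (\<lambda>s. f (y + s *\<^sub>R b))"
      using d1 by (intro continuous_at_imp_continuous_on) (auto intro: DERIV_isCont)
  qed
  then show False using mx[of s] s by simp
qed

lemma poly_fun_line: "poly_fun B m f \<Longrightarrow> \<exists>P. \<forall>s::real. f (s *\<^sub>R x) = poly P s"
proof (induction rule: poly_fun.induct)
  case (const m c) then show ?case by (intro exI[of _ "[:c:]"]) simp
next
  case (add m f g)
  then obtain P Q where "\<forall>s. f (s *\<^sub>R x) = poly P s" "\<forall>s. g (s *\<^sub>R x) = poly Q s" by blast
  then show ?case by (intro exI[of _ "P + Q"]) simp
next
  case (mult b m f)
  then obtain P where "\<forall>s. f (s *\<^sub>R x) = poly P s" by blast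
  then show ?case by (intro exI[of _ "[:0, b \<bullet> x:] * P"]) (simp add: mult.commute mult.left_commute)
qed

section \<open>Sums of viscosity subharmonic functions\<close>

text \<open>The vector e is a unit normal, in the main argument the direction of p - q, and B is an
  orthonormal basis of the hyperplane orthogonal to it.\<close>

locale frame =
  fixes e :: "'a::euclidean_space" and B :: "'a set"
  assumes orth: "pairwise orthogonal (insert e B)"
    and unit: "\<And>b. b \<in> insert e B \<Longrightarrow> norm b = 1"
    and sp: "span (insert e B) = UNIV" and notin: "e \<notin> B"
begin

lemma finite_B: "finite B" and card_B: "card B = DIM('a) - 1"
  using orthonormal_parseval(1,5)[OF orth unit sp] notin by auto

lemma inner_B: "b \<in> B \<Longrightarrow> c \<in> B \<Longrightarrow> b \<bullet> c = (if b = c then 1 else 0)"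
  and inner_eB: "b \<in> B \<Longrightarrow> e \<bullet> b = 0" "b \<in> B \<Longrightarrow> b \<bullet> e = 0"
  and inner_ee: "e \<bullet> e = 1"
  using orth unit notin by (auto simp: pairwise_insert pairwise_def orthogonal_def dot_square_norm inner_commute)

lemma norm_B: "b \<in> B \<Longrightarrow> norm b = 1" using unit by auto

lemma expand: "x = (e \<bullet> x) *\<^sub>R e + (\<Sum>b\<in>B. (b \<bullet> x) *\<^sub>R b)"
  using orthonormal_parseval(2)[OF orth unit sp, of x] finite_B notin by (simp add: inner_commute)

lemma norm_sq: "(norm x)\<^sup>2 = (e \<bullet> x)\<^sup>2 + (\<Sum>b\<in>B. (b \<bullet> x)\<^sup>2)"
  using orthonormal_parseval(4)[OF orth unit sp, of x] finite_B notin by (simp add: inner_commute)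

section \<open>Maximum principle and Dirichlet problem on a disc in the hyperplane\<close>

definition hdisc :: "real \<Rightarrow> 'a set" where "hdisc \<rho> = {x. norm x \<le> \<rho> \<and> e \<bullet> x = 0}"
definition hsphere :: "real \<Rightarrow> 'a set" where "hsphere \<rho> = {x. norm x = \<rho> \<and> e \<bullet> x = 0}"

lemma compact_hdisc: "compact (hdisc \<rho>)"
proof -
  have "hdisc \<rho> = cball 0 \<rho> \<inter> {x. e \<bullet> x = 0}" by (auto simp: hdisc_def)
  then show ?thesis using compact_Int_closed[OF compact_cball closed_hyperplane] by metis
qed

lemma compact_hsphere: "compact (hsphere \<rho>)"
proof -
  have "hsphere \<rho> = sphere 0 \<rho> \<inter> {x. e \<bullet> x = 0}" by (auto simp: hsphere_def)
  then show ?thesis using compact_Int_closed[OF compact_sphere closed_hyperplane] by metis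
qed

text \<open>A small multiple of |x|^2 makes the partial Laplacian positive, whereas at an interior
  maximum every second derivative along B is at most zero.\<close>

lemma harmonic_le_0:
  assumes B: "B \<noteq> {}" and W: "C2_data UNIV W g H"
    and lap: "\<And>x. (\<Sum>b\<in>B. H x b \<bullet> b) = 0"
    and bdry: "\<And>x. x \<in> hsphere \<rho> \<Longrightarrow> W x = 0" and x: "x \<in> hdisc \<rho>"
  shows "W x \<le> 0"
proof (rule ccontr)
  assume "\<not> W x \<le> 0"
  then have pos: "W x > 0" by simp
  \<comment> \<open>Small enough that on the sphere, where W vanishes, the added term stays below W
    x; this keeps the maximum of F off the sphere.\<close>
  define c where "c = W x / (2 * (\<rho>\<^sup>2 + 1))"
  have c: "c > 0" "c * \<rho>\<^sup>2 < W x"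
  proof -
    have p: "\<rho>\<^sup>2 + 1 > 0" by (simp add: add_nonneg_pos)
    show "c > 0" using pos p by (simp add: c_def)
    have "c * (2 * (\<rho>\<^sup>2 + 1)) = W x" using p by (simp add: c_def)
    then have "2 * (c * \<rho>\<^sup>2) + 2 * c = W x" by (simp add: algebra_simps)
    moreover have "0 \<le> c * \<rho>\<^sup>2" using \<open>c > 0\<close> by simp
    ultimately show "c * \<rho>\<^sup>2 < W x" using \<open>c > 0\<close> by linarith
  qed
  define F where "F = (\<lambda>x. W x + c * (norm x)\<^sup>2)"
  have F: "C2_data UNIV F (\<lambda>x. g x + c *\<^sub>R 2 *\<^sub>R x) (\<lambda>x v. H x v + c *\<^sub>R 2 *\<^sub>R v)"
    unfolding F_def by (rule C2_data_add[OF W C2_data_cmult[OF C2_data_norm_sq]])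
  have "\<exists>y\<in>hdisc \<rho>. \<forall>z\<in>hdisc \<rho>. F z \<le> F y"
    using compact_hdisc x C2_dataD(6)[OF F]
    by (intro continuous_attains_sup) (auto intro: continuous_on_subset)
  then obtain y where y: "y \<in> hdisc \<rho>" "\<And>z. z \<in> hdisc \<rho> \<Longrightarrow> F z \<le> F y" by blast
  have "y \<notin> hsphere \<rho>"
  proof
    assume ys: "y \<in> hsphere \<rho>"
    then have "F y = c * \<rho>\<^sup>2" using bdry by (simp add: F_def hsphere_def)
    moreover have "F x \<ge> W x" using c by (simp add: F_def)
    ultimately show False using y(2)[OF x] c by simp
  qed
  then have ny: "norm y < \<rho>" "e \<bullet> y = 0" using y(1) by (auto simp: hdisc_def hsphere_def)
  have "(H y b + c *\<^sub>R 2 *\<^sub>R b) \<bullet> b \<le> 0" if b: "b \<in> B" for b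
  proof (rule second_derivative_local_max[OF F, of "\<rho> - norm y"])
    fix s :: real assume s: "\<bar>s\<bar> < \<rho> - norm y"
    have "norm (y + s *\<^sub>R b) \<le> \<rho>"
      using norm_triangle_ineq[of y "s *\<^sub>R b"] s norm_B[OF b] by simp
    then show "F (y + s *\<^sub>R b) \<le> F y"
      using ny(2) inner_eB[OF b] by (intro y(2)) (simp add: hdisc_def inner_add_right)
  qed (use ny in simp)
  then have le: "H y b \<bullet> b \<le> - (2 * c)" if "b \<in> B" for b
    using that norm_B[OF that] by (force simp: inner_add_left dot_square_norm)
  have "(\<Sum>b\<in>B. H y b \<bullet> b) \<le> (\<Sum>b\<in>B. - (2 * c))" by (rule sum_mono) (rule le)
  also have "\<dots> < 0" using c B finite_B by (simp add: card_gt_0_iff)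
  finally show False using lap by simp
qed

lemma poly_fun_proj: "poly_fun B m f \<Longrightarrow> f (x - (e \<bullet> x) *\<^sub>R e) = f x"
  by (induction rule: poly_fun.induct) (simp_all add: inner_diff_right inner_eB)

text \<open>On a line through the origin f is a polynomial in one variable with infinitely many
  zeros. Points off the hyperplane are covered because f does not see the normal component.\<close>

lemma poly_fun_eq_0:
  assumes f: "poly_fun B m f" and \<rho>: "\<rho> > 0"
    and z: "\<And>x. e \<bullet> x = 0 \<Longrightarrow> norm x < \<rho> \<Longrightarrow> f x = 0"
  shows "f x = 0"
proof -
  define y where "y = x - (e \<bullet> x) *\<^sub>R e"
  have ey: "e \<bullet> y = 0" by (simp add: y_def inner_diff_right inner_ee)
  obtain P where P: "\<And>s::real. f (s *\<^sub>R y) = poly P s" using poly_fun_line[OF f] by blast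
  have "{0<..<\<rho> / (norm y + 1)} \<subseteq> {s. poly P s = 0}"
  proof
    fix s assume s: "s \<in> {0<..<\<rho> / (norm y + 1)}"
    have "norm (s *\<^sub>R y) \<le> s * (norm y + 1)" using s by (simp add: mult_left_mono)
    also have "\<dots> < \<rho>" using s by (simp add: less_divide_eq add_nonneg_pos)
    finally show "s \<in> {s. poly P s = 0}" using z[of "s *\<^sub>R y"] ey by (simp add: P[symmetric])
  qed
  moreover have "infinite {0<..<\<rho> / (norm y + 1)}"
    using \<rho> by (intro infinite_Ioo) (simp add: add_nonneg_pos)
  ultimately have "infinite {s. poly P s = 0}" using finite_subset by blast
  then have "P = 0" using poly_roots_finite by blast
  then have "f y = 0" using P[of 1] by simp
  then show ?thesis using poly_fun_proj[OF f] by (simp add: y_def)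
qed

text \<open>The map \<open>p \<mapsto> \<Delta>((\<rho>\<^sup>2 - |x|\<^sup>2) p)\<close> preserves the degree bound and is injective by the
  maximum principle, hence onto; so polynomial boundary data have polynomial harmonic extensions.\<close>

lemma polynomial_Dirichlet:
  assumes B: "B \<noteq> {}" and \<rho>: "\<rho> > 0" and P: "poly_fun B m P"
  shows "\<exists>k h. poly_fun B k h \<and> (\<forall>x. partial_laplacian B h x = 0) \<and> (\<forall>x\<in>hsphere \<rho>. h x = P x)"
proof -
  \<comment> \<open>This agrees with \<rho>^2 - |x|^2 on the hyperplane only; written in the
    coordinates of B it belongs to \<open>poly_fun B 2\<close>.\<close>
  define q where "q = (\<lambda>x. \<rho>\<^sup>2 - (\<Sum>b\<in>B. (b \<bullet> x)\<^sup>2))"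
  have q2: "poly_fun B 2 q"
  proof -
    have "poly_fun B 2 (\<lambda>x. (b \<bullet> x)\<^sup>2)" if "b \<in> B" for b
      using poly_fun_mult[OF poly_fun_inner[OF that] poly_fun_inner[OF that]]
      by (simp add: power2_eq_square numeral_2_eq_2)
    then show ?thesis unfolding q_def by (intro poly_fun_diff poly_fun_sum poly_fun.const)
  qed
  have qe: "q x = \<rho>\<^sup>2 - (norm x)\<^sup>2" if "e \<bullet> x = 0" for x
    using that by (simp add: q_def norm_sq)
  have P2: "poly_fun B (m + 2) P" using P by (rule poly_fun_mono) simp
  define L where "L = (\<lambda>p. partial_laplacian B (\<lambda>x. q x * p x))"
  obtain T where T: "finite T" "real_fun.span T = {f. poly_fun B m f}"
    using poly_fun_finite_span[OF finite_B] by blast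
  have qp: "poly_fun B (m + 2) (\<lambda>x. q x * p x)" if "poly_fun B m p" for p
    using poly_fun_mult[OF q2 that] by (simp add: add.commute)
  have "\<exists>p\<in>real_fun.span T. L p = partial_laplacian B P"
  proof (rule real_fun.injective_on_finite_span_surjective[OF T(1)])
    fix f g assume "f \<in> real_fun.span T" "g \<in> real_fun.span T"
    then have "poly_fun B m f" "poly_fun B m g" by (auto simp: T(2))
    then obtain g1 H1 g2 H2 where
      "C2_data UNIV (\<lambda>x. q x * f x) g1 H1" "C2_data UNIV (\<lambda>x. q x * g x) g2 H2"
      using poly_fun_C2_data[OF qp] by metis
    from partial_laplacian_add[OF this, of B]
    show "L (f + g) = L f + L g" by (simp add: L_def fun_eq_iff distrib_left)
  next
    fix c f assume "f \<in> real_fun.span T"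
    then have "poly_fun B m f" by (auto simp: T(2))
    then obtain g1 H1 where "C2_data UNIV (\<lambda>x. q x * f x) g1 H1"
      using poly_fun_C2_data[OF qp] by metis
    from partial_laplacian_cmult[OF this, of B c]
    show "L (\<lambda>x. c * f x) = (\<lambda>x. c * L f x)" by (simp add: L_def fun_eq_iff mult.left_commute)
  next
    fix f assume "f \<in> real_fun.span T"
    then show "L f \<in> real_fun.span T"
      using poly_fun_partial_laplacian[OF qp] by (auto simp: T(2) L_def)
  next
    fix f assume f: "f \<in> real_fun.span T" and L0: "L f = 0"
    then have fm: "poly_fun B m f" by (auto simp: T(2))
    obtain g H where W: "C2_data UNIV (\<lambda>x. q x * f x) g H"
      using poly_fun_C2_data[OF qp[OF fm]] by metis
    have lap: "(\<Sum>b\<in>B. H x b \<bullet> b) = 0" for x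
      using fun_cong[OF L0, of x] partial_laplacian_C2_data[OF W, of B x] by (simp add: L_def)
    have W': "C2_data UNIV (\<lambda>x. (-1) * (q x * f x)) (\<lambda>x. (-1) *\<^sub>R g x) (\<lambda>x v. (-1) *\<^sub>R H x v)"
      by (rule C2_data_cmult[OF W])
    have zero: "q x = 0" if "x \<in> hsphere \<rho>" for x using that qe by (simp add: hsphere_def)
    have "f x = 0" if "e \<bullet> x = 0" "norm x < \<rho>" for x
    proof -
      have x: "x \<in> hdisc \<rho>" using that by (simp add: hdisc_def)
      have "q x * f x \<le> 0"
        by (rule harmonic_le_0[OF B W lap _ x]) (simp add: zero)
      moreover have "(-1) * (q x * f x) \<le> 0"
        by (rule harmonic_le_0[OF B W' _ _ x]) (simp_all add: zero lap sum_negf)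
      moreover have "q x > 0" using that \<rho> by (simp add: qe power_strict_mono)
      ultimately show "f x = 0" by auto
    qed
    then show "f = 0" using poly_fun_eq_0[OF fm \<rho>] by (simp add: fun_eq_iff)
  next
    show "partial_laplacian B P \<in> real_fun.span T"
      using poly_fun_partial_laplacian[OF P2] by (simp add: T(2))
  qed
  then obtain p where p: "poly_fun B m p" "L p = partial_laplacian B P" by (auto simp: T(2))
  \<comment> \<open>Since q vanishes on the sphere, subtracting q p keeps the boundary values of P,
    and the choice of p removes the partial Laplacian of P.\<close>
  define h where "h = (\<lambda>x. P x + (-1) * (q x * p x))"
  obtain g1 H1 g2 H2 where d: "C2_data UNIV P g1 H1" "C2_data UNIV (\<lambda>x. q x * p x) g2 H2"
    using poly_fun_C2_data[OF qp[OF p(1)]] poly_fun_C2_data[OF P] by metis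
  have "partial_laplacian B h x = 0" for x
    using fun_cong[OF p(2), of x]
    unfolding h_def partial_laplacian_add[OF d(1) C2_data_cmult[OF d(2)]] partial_laplacian_cmult[OF d(2)]
    by (simp add: L_def)
  moreover have "poly_fun B (m + 2) h"
    unfolding h_def by (intro poly_fun.add poly_fun_scale P2 qp p)
  moreover have "h x = P x" if "x \<in> hsphere \<rho>" for x
    using that qe by (simp add: h_def hsphere_def)
  ultimately show ?thesis by blast
qed

text \<open>Polynomials from the Stone-Weierstrass theorem depend on all coordinates. Composing with
  the projection to the hyperplane removes the normal one and changes no value on the
  hyperplane.\<close>

lemma real_polynomial_function_poly_fun:
  "real_polynomial_function p \<Longrightarrow> \<exists>m. poly_fun B m (\<lambda>x. p (x - (e \<bullet> x) *\<^sub>R e))"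
proof (induction rule: real_polynomial_function.induct)
  case (linear f)
  have "f (x - (e \<bullet> x) *\<^sub>R e) = (\<Sum>b\<in>B. f b * (b \<bullet> x))" for x
  proof -
    have "x - (e \<bullet> x) *\<^sub>R e = (\<Sum>b\<in>B. (b \<bullet> x) *\<^sub>R b)" using expand[of x] by (simp add: algebra_simps)
    then show ?thesis
      using linear by (simp add: bounded_linear.linear linear_sum linear_cmul mult.commute)
  qed
  moreover have "poly_fun B 1 (\<lambda>x. \<Sum>b\<in>B. f b * (b \<bullet> x))"
    by (intro poly_fun_sum poly_fun_scale poly_fun_inner)
  ultimately show ?case by auto
next
  case (const c)
  then show ?case using poly_fun.const by blast
next
  case (add f g)
  then obtain m k where "poly_fun B m (\<lambda>x. f (x - (e \<bullet> x) *\<^sub>R e))" "poly_fun B k (\<lambda>x. g (x - (e \<bullet> x) *\<^sub>R e))"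
    by blast
  then have "poly_fun B (m + k) (\<lambda>x. f (x - (e \<bullet> x) *\<^sub>R e))" "poly_fun B (m + k) (\<lambda>x. g (x - (e \<bullet> x) *\<^sub>R e))"
    by (auto intro: poly_fun_mono)
  then show ?case using poly_fun.add by blast
next
  case (mult f g)
  then show ?case using poly_fun_mult by blast
qed

text \<open>Test functions are defined on the whole space and must lie above f on the whole closed
  ball. This leaves fewer of them, so the property is easier to establish, yet it suffices for
  comparison. Touching is tested in all directions although the Laplacian is only that of the
  hyperplane.\<close>

definition strictly_subharmonic_viscosity :: "real \<Rightarrow> real \<Rightarrow> ('a \<Rightarrow> real) \<Rightarrow> bool" where
  "strictly_subharmonic_viscosity \<delta> \<rho> f \<longleftrightarrow> continuous_on (cball 0 \<rho>) f \<and>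
     (\<forall>\<Psi> g H y. C2_data UNIV \<Psi> g H \<and> y \<in> ball 0 \<rho> \<and> (\<forall>x\<in>cball 0 \<rho>. f x \<le> \<Psi> x) \<and> f y = \<Psi> y
        \<longrightarrow> (\<Sum>b\<in>B. H y b \<bullet> b) > \<delta>)"

lemma strictly_subharmonic_viscosityD:
  assumes "strictly_subharmonic_viscosity \<delta> \<rho> f" "C2_data UNIV \<Psi> g H" "y \<in> ball 0 \<rho>"
    "\<And>x. x \<in> cball 0 \<rho> \<Longrightarrow> f x \<le> \<Psi> x" "f y = \<Psi> y"
  shows "(\<Sum>b\<in>B. H y b \<bullet> b) > \<delta>"
  using assms unfolding strictly_subharmonic_viscosity_def by blast

text \<open>The term \<open>K (e \<bullet> x)\<^sup>2\<close> is not seen by the partial Laplacian; for large \<open>K\<close> it turns a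
  comparison on the hyperplane into one on a full ball.\<close>

lemma viscosity_comparison:
  assumes f: "strictly_subharmonic_viscosity \<delta> \<rho> f" and \<rho>: "\<rho> > 0"
    and h: "C2_data UNIV h g H" and lap: "\<And>x. (\<Sum>b\<in>B. H x b \<bullet> b) \<le> \<delta>"
    and bdry: "\<And>x. x \<in> hsphere \<rho> \<Longrightarrow> f x < h x"
  shows "f 0 \<le> h 0"
proof (rule ccontr)
  assume "\<not> f 0 \<le> h 0"
  have fc: "continuous_on (cball 0 \<rho>) f" using f by (simp add: strictly_subharmonic_viscosity_def)
  have hc: "continuous_on A h" for A using C2_dataD(6)[OF h] continuous_on_subset by blast
  have fh: "continuous_on (cball 0 \<rho>) (\<lambda>x. f x - h x)" by (intro continuous_intros fc hc)
  obtain K where K: "\<And>x. norm x = \<rho> \<Longrightarrow> f x < h x + K * (e \<bullet> x)\<^sup>2"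
  proof -
    \<comment> \<open>The bad part of the sphere is compact and misses the hyperplane by
      \<open>bdry\<close>, so the squared normal component has a positive minimum on it, and a large
      multiple of that square outweighs the bounded excess f - h.\<close>
    define Z where "Z = {x \<in> sphere 0 \<rho>. 0 \<le> f x - h x}"
    have "closed Z" unfolding Z_def
      using continuous_closed_preimage[OF continuous_on_subset[OF fh, of "sphere 0 \<rho>"] closed_sphere closed_atLeast[of 0]]
      by (simp add: vimage_def Int_def sphere_def cball_def subset_iff)
    moreover have "bounded Z" by (rule bounded_subset[OF bounded_sphere, of _ 0 \<rho>]) (auto simp: Z_def)
    ultimately have cZ: "compact Z" by (simp add: compact_eq_bounded_closed)
    show thesis
    proof (cases "Z = {}")
      case True
      then show ?thesis by (intro that[of 0]) (force simp: Z_def not_le)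
    next
      case False
      have "continuous_on Z (\<lambda>x. (e \<bullet> x)\<^sup>2)" by (intro continuous_intros)
      then obtain z where z: "z \<in> Z" "\<And>x. x \<in> Z \<Longrightarrow> (e \<bullet> z)\<^sup>2 \<le> (e \<bullet> x)\<^sup>2"
        using continuous_attains_inf[OF cZ False] by blast
      have "continuous_on Z (\<lambda>x. f x - h x)" by (rule continuous_on_subset[OF fh]) (auto simp: Z_def)
      then obtain w where w: "w \<in> Z" "\<And>x. x \<in> Z \<Longrightarrow> f x - h x \<le> f w - h w"
        using continuous_attains_sup[OF cZ False] by blast
      have "e \<bullet> z \<noteq> 0" using bdry[of z] z(1) by (auto simp: Z_def hsphere_def)
      then have m: "(e \<bullet> z)\<^sup>2 > 0" by simp
      define M where "M = f w - h w + 1"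
      have M: "M > 0" using w(1) by (auto simp: Z_def M_def)
      show ?thesis
      proof (rule that[of "M / (e \<bullet> z)\<^sup>2"])
        fix x :: 'a assume x: "norm x = \<rho>"
        have K0: "M / (e \<bullet> z)\<^sup>2 \<ge> 0" using M by simp
        show "f x < h x + M / (e \<bullet> z)\<^sup>2 * (e \<bullet> x)\<^sup>2"
        proof (cases "x \<in> Z")
          case True
          have "M = M / (e \<bullet> z)\<^sup>2 * (e \<bullet> z)\<^sup>2" using m by simp
          also have "\<dots> \<le> M / (e \<bullet> z)\<^sup>2 * (e \<bullet> x)\<^sup>2" using z(2)[OF True] K0 by (rule mult_left_mono)
          finally show ?thesis using w(2)[OF True] by (simp add: M_def)
        next
          case False
          moreover have "0 \<le> M / (e \<bullet> z)\<^sup>2 * (e \<bullet> x)\<^sup>2" by (intro mult_nonneg_nonneg K0) simp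
          ultimately show ?thesis using x unfolding Z_def by auto
        qed
      qed
    qed
  qed
  define \<Psi> where "\<Psi> = (\<lambda>x. h x + K * ((e \<bullet> x) * (e \<bullet> x)))"
  note d = C2_data_add[OF h C2_data_cmult[OF C2_data_mult[OF C2_data_inner[of e] C2_data_inner[of e]], of K]]
  have "continuous_on (cball 0 \<rho>) (\<lambda>x. f x - \<Psi> x)" unfolding \<Psi>_def by (intro continuous_intros fc hc)
  then obtain y where y: "y \<in> cball 0 \<rho>" "\<And>x. x \<in> cball 0 \<rho> \<Longrightarrow> f x - \<Psi> x \<le> f y - \<Psi> y"
    using continuous_attains_sup[OF compact_cball, of 0 \<rho> "\<lambda>x. f x - \<Psi> x"] \<rho> by auto
  \<comment> \<open>The added term vanishes at 0, so the maximum of f - \<Psi> is positive and by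
    the choice of K lies off the sphere. Raising \<Psi> by this maximum makes it touch f from above
    at y.\<close>
  have "0 < f y - \<Psi> y" using y(2)[of 0] \<open>\<not> f 0 \<le> h 0\<close> \<rho> by (simp add: \<Psi>_def)
  then have "norm y \<noteq> \<rho>" using K[of y] by (auto simp: \<Psi>_def power2_eq_square)
  then have yb: "y \<in> ball 0 \<rho>" using y(1) by auto
  note d' = C2_data_add[OF d C2_data_const[of "f y - \<Psi> y"]]
  have "(\<Sum>b\<in>B. H y b \<bullet> b) = (\<Sum>b\<in>B. (H y b + K *\<^sub>R ((e \<bullet> y) *\<^sub>R 0 + (e \<bullet> y) *\<^sub>R 0 + (e \<bullet> b) *\<^sub>R e + (e \<bullet> b) *\<^sub>R e) + 0) \<bullet> b)"
    by (simp add: inner_eB)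
  also have "\<dots> > \<delta>"
    by (rule strictly_subharmonic_viscosityD[OF f d' yb])
      (use y(2) in \<open>auto simp: \<Psi>_def algebra_simps\<close>)
  finally show False using lap[of y] by simp
qed

text \<open>Let M be the alleged maximum and h a harmonic function within t of f1 on the sphere of
  the hyperplane. Then h + c (|x|^2 - \<rho>^2) + t is above f1 there and M - h + t is above f2.
  Comparing both at the centre and adding gives M \<le> M + 2 t - c \<rho>^2.\<close>

lemma no_max_of_sum:
  assumes B: "B \<noteq> {}" and \<rho>: "\<rho> > 0" and \<delta>: "\<delta> > 0"
    and f1: "strictly_subharmonic_viscosity \<delta> \<rho> f1" and f2: "strictly_subharmonic_viscosity \<delta> \<rho> f2"
    and mx: "\<And>x. x \<in> cball 0 \<rho> \<Longrightarrow> f1 x + f2 x \<le> f1 0 + f2 0"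
  shows False
proof -
  define n where "n = real (card B)"
  have n: "n > 0" using B finite_B by (simp add: n_def card_gt_0_iff)
  \<comment> \<open>The partial Laplacian of c |x|^2 is 2 n c, so this c uses up exactly the
    admissible \<delta>. The tolerance t below is a quarter of c \<rho>^2, so that 2 t is smaller
    than c \<rho>^2.\<close>
  define c where "c = \<delta> / (2 * n)"
  have c: "c > 0" using n \<delta> by (simp add: c_def)
  define t where "t = c * \<rho>\<^sup>2 / 4"
  have t: "t > 0" using c \<rho> by (simp add: t_def)
  have "continuous_on (hsphere \<rho>) f1"
    using f1 by (auto simp: strictly_subharmonic_viscosity_def hsphere_def elim: continuous_on_subset)
  then obtain p where p: "real_polynomial_function p" "\<And>x. x \<in> hsphere \<rho> \<Longrightarrow> \<bar>f1 x - p x\<bar> < t"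
    using Stone_Weierstrass_real_polynomial_function[OF compact_hsphere _ t] by metis
  obtain m where m: "poly_fun B m (\<lambda>x. p (x - (e \<bullet> x) *\<^sub>R e))"
    using real_polynomial_function_poly_fun[OF p(1)] by blast
  obtain k h where h: "poly_fun B k h" "\<And>x. partial_laplacian B h x = 0"
      "\<And>x. x \<in> hsphere \<rho> \<Longrightarrow> h x = p (x - (e \<bullet> x) *\<^sub>R e)"
    using polynomial_Dirichlet[OF B \<rho> m] by blast
  have hp: "\<bar>f1 x - h x\<bar> < t" if "x \<in> hsphere \<rho>" for x
    using that h(3) p(2) by (simp add: hsphere_def)
  obtain g H where C: "C2_data UNIV h g H" using poly_fun_C2_data[OF h(1)] by blast
  have lap: "(\<Sum>b\<in>B. H x b \<bullet> b) = 0" for x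
    using h(2)[of x] by (simp add: partial_laplacian_C2_data[OF C])
  have "f1 0 \<le> h 0 + c * (norm (0::'a))\<^sup>2 + (t - c * \<rho>\<^sup>2)"
  proof (rule viscosity_comparison[OF f1 \<rho> C2_data_add[OF C2_data_add[OF C C2_data_cmult[OF C2_data_norm_sq]] C2_data_const]])
    show "(\<Sum>b\<in>B. (H x b + c *\<^sub>R 2 *\<^sub>R b + 0) \<bullet> b) \<le> \<delta>" for x
    proof -
      have "(\<Sum>b\<in>B. (H x b + c *\<^sub>R 2 *\<^sub>R b + 0) \<bullet> b) = (\<Sum>b\<in>B. H x b \<bullet> b + 2 * c)"
        by (rule sum.cong) (auto simp: inner_add_left inner_B)
      also have "\<dots> = \<delta>" using lap n by (simp add: sum.distrib c_def n_def)
      finally show ?thesis by simp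
    qed
    show "f1 x < h x + c * (norm x)\<^sup>2 + (t - c * \<rho>\<^sup>2)" if "x \<in> hsphere \<rho>" for x
      using hp[OF that] that by (simp add: hsphere_def abs_less_iff)
  qed
  moreover have "f2 0 \<le> (-1) * h 0 + (f1 0 + f2 0 + t)"
  proof (rule viscosity_comparison[OF f2 \<rho> C2_data_add[OF C2_data_cmult[OF C] C2_data_const]])
    show "(\<Sum>b\<in>B. ((- 1) *\<^sub>R H x b + 0) \<bullet> b) \<le> \<delta>" for x
      using lap \<delta> by (simp add: sum_negf)
    show "f2 x < (-1) * h x + (f1 0 + f2 0 + t)" if "x \<in> hsphere \<rho>" for x
      using hp[OF that] mx[of x] that by (simp add: hsphere_def abs_less_iff)
  qed
  moreover have "c * \<rho>\<^sup>2 > 0" using c \<rho> by simp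
  ultimately show False by (simp add: t_def)
qed

end

section \<open>A mountain pass splitting\<close>

text \<open>Mountain pass: \<open>c\<close> is the supremum of the levels at which the sublevel set of \<open>V\<close> is split
  by two closed sets containing the two parts of the frontier. Since \<open>V\<close> has no local minima, the
  splittings of different levels are compatible with each other.\<close>

lemma mountain_pass_splitting:
  fixes V :: "'a::euclidean_space \<Rightarrow> real"
  assumes \<Omega>: "open \<Omega>" "connected \<Omega>" "bounded \<Omega>" and nc: "\<not> connected (frontier \<Omega>)"
    and V: "continuous_on (closure \<Omega>) V"
    and V0: "\<And>x. x \<in> frontier \<Omega> \<Longrightarrow> V x = 0" and Vpos: "\<And>x. x \<in> \<Omega> \<Longrightarrow> V x > 0"
    and nomin: "\<And>y. y \<in> \<Omega> \<Longrightarrow> \<not> (\<forall>\<^sub>F x in nhds y. V y \<le> V x)"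
  obtains c E F where "c > 0" "open E" "open F" "E \<inter> F = {}" "E \<union> F = {x\<in>\<Omega>. V x < c}"
    "closure E \<inter> closure F \<noteq> {}" "closure E \<inter> closure F \<subseteq> \<Omega>"
proof -
  have cl: "closure \<Omega> = \<Omega> \<union> frontier \<Omega>" "\<Omega> \<inter> frontier \<Omega> = {}"
    by (rule closure_Un_frontier) (use \<Omega>(1) in \<open>auto simp: frontier_def interior_open\<close>)
  have compact_X: "compact (closure \<Omega>)" using \<Omega>(3) by (simp add: compact_closure)
  have V_nonneg: "V x \<ge> 0" if "x \<in> closure \<Omega>" for x
    using that Vpos V0 cl by (metis UnE less_imp_le order_refl)
  obtain A B where AB: "closed A" "closed B" "A \<inter> B = {}" "A \<union> B = frontier \<Omega>" "A \<noteq> {}" "B \<noteq> {}"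
  proof -
    obtain A B where "closed A" "closed B" "frontier \<Omega> \<subseteq> A \<union> B" "A \<inter> B \<inter> frontier \<Omega> = {}"
        "A \<inter> frontier \<Omega> \<noteq> {}" "B \<inter> frontier \<Omega> \<noteq> {}"
      using nc unfolding connected_closed by auto
    then show thesis
      by (intro that[of "A \<inter> frontier \<Omega>" "B \<inter> frontier \<Omega>"]) (auto intro!: closed_Int)
  qed
  define K where "K t = {x \<in> closure \<Omega>. V x \<le> t}" for t
  have closed_K: "closed (K t)" for t
    using continuous_closed_preimage[OF V closed_closure closed_atMost[of t]]
    by (simp add: K_def vimage_def Int_def)
  define sep where "sep t P Q \<longleftrightarrow> closed P \<and> closed Q \<and> P \<inter> Q = {} \<and> P \<union> Q = K t \<and> A \<subseteq> P \<and> B \<subseteq> Q"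
    for t P Q
  have frK: "A \<union> B \<subseteq> K t" if "t \<ge> 0" for t using that AB(4) V0 cl by (auto simp: K_def)
  have sep_mono: "sep s (P \<inter> K s) (Q \<inter> K s)" if "sep t P Q" "0 \<le> s" "s \<le> t" for s t P Q
  proof -
    have "K s \<subseteq> K t" using that by (auto simp: K_def)
    then show ?thesis using that frK[of s] closed_K by (auto simp: sep_def closed_Int)
  qed
  \<comment> \<open>Separate P and Q by disjoint open sets. On the compact remainder V exceeds t,
    hence exceeds some larger s, and the sublevel set of s is still covered.\<close>
  have sep_open: "\<exists>s>t. \<exists>P' Q'. sep s P' Q'" if S: "sep t P Q" for t P Q
  proof -
    obtain U W where UW: "open U" "open W" "P \<subseteq> U" "Q \<subseteq> W" "U \<inter> W = {}"
      using separation_normal[of P Q] S unfolding sep_def by metis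
    define C where "C = closure \<Omega> - (U \<union> W)"
    have "compact C" unfolding C_def by (intro compact_diff compact_X open_Un UW)
    have gt: "V x > t" if "x \<in> C" for x
      using that UW S unfolding C_def sep_def K_def by force
    have "\<exists>s>t. \<forall>x\<in>C. V x > s"
    proof (cases "C = {}")
      case False
      have "continuous_on C V" using V by (rule continuous_on_subset) (auto simp: C_def)
      then obtain z where z: "z \<in> C" "\<And>x. x \<in> C \<Longrightarrow> V z \<le> V x"
        using continuous_attains_inf[OF \<open>compact C\<close> False] by blast
      then show ?thesis using gt[OF z(1)] by (intro exI[of _ "(t + V z) / 2"]) force
    qed (auto intro: exI[of _ "t + 1"])
    then obtain s where s: "s > t" "\<And>x. x \<in> C \<Longrightarrow> V x > s" by blast
    have "K s \<subseteq> U \<union> W" using s(2) by (force simp: K_def C_def)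
    moreover have "P \<subseteq> K s" "Q \<subseteq> K s" using S s(1) unfolding sep_def K_def by force+
    moreover have "A \<subseteq> P" "B \<subseteq> Q" using S by (auto simp: sep_def)
    ultimately have "sep s (K s - W) (K s - U)"
      using UW closed_K[of s] unfolding sep_def by (auto simp: closed_Diff)
    then show ?thesis using s(1) by blast
  qed
  have K0: "K 0 = A \<union> B"
  proof -
    have "x \<in> K 0 \<longleftrightarrow> x \<in> frontier \<Omega>" for x
      using Vpos[of x] V0[of x] cl by (auto simp: K_def)
    then show ?thesis using AB(4) by auto
  qed
  have sep0: "sep 0 A B" using AB K0 by (simp add: sep_def)
  define S where "S = {t. t \<ge> 0 \<and> (\<exists>P Q. sep t P Q)}"
  define c where "c = Sup S"
  have "\<exists>z\<in>closure \<Omega>. \<forall>x\<in>closure \<Omega>. V x \<le> V z"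
    using compact_X V AB(4,5) cl by (intro continuous_attains_sup) auto
  then obtain z where z: "\<And>x. x \<in> closure \<Omega> \<Longrightarrow> V x \<le> V z" by blast
  \<comment> \<open>Above the maximum of V the sublevel set is all of
    \<open>closure \<Omega>\<close>, which is connected and so cannot be separated.\<close>
  have bdd: "t \<le> V z" if tS: "t \<in> S" for t
  proof (rule ccontr)
    assume "\<not> t \<le> V z"
    then have "K t = closure \<Omega>" using z by (force simp: K_def)
    then obtain P Q where PQ: "closed P" "closed Q" "P \<inter> Q = {}" "P \<union> Q = closure \<Omega>" "A \<subseteq> P" "B \<subseteq> Q"
      using tS by (auto simp: S_def sep_def)
    have "connected (closure \<Omega>)" using \<Omega>(2) by (rule connected_imp_connected_closure)
    moreover have "P \<inter> Q \<inter> closure \<Omega> = {}" "closure \<Omega> \<subseteq> P \<union> Q"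
        "P \<inter> closure \<Omega> \<noteq> {}" "Q \<inter> closure \<Omega> \<noteq> {}"
      using PQ(3,4) PQ(5,6)[THEN subset_trans, of "closure \<Omega>"] AB(5,6) PQ(5,6) by blast+
    ultimately show False unfolding connected_closed using PQ(1,2) by blast
  qed
  have bddS: "bdd_above S" by (rule bdd_aboveI) (rule bdd)
  have S0: "0 \<in> S" using sep0 by (auto simp: S_def)
  have notc: "\<not> sep c P Q" for P Q
  proof
    assume "sep c P Q"
    then obtain s P' Q' where s: "s > c" "sep s P' Q'" using sep_open by blast
    moreover have "c \<ge> 0" unfolding c_def by (rule cSup_upper[OF S0 bddS])
    ultimately have "s \<in> S" by (auto simp: S_def)
    then have "s \<le> c" unfolding c_def by (rule cSup_upper[OF _ bddS])
    then show False using s by simp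
  qed
  have c0: "c > 0"
  proof -
    have "c \<ge> 0" unfolding c_def by (rule cSup_upper[OF S0 bddS])
    moreover have "c \<noteq> 0" using notc sep0 by blast
    ultimately show ?thesis by simp
  qed
  have ex_sep: "\<exists>P Q. sep t P Q" if t: "0 \<le> t" "t < c" for t
  proof -
    obtain s where s: "s \<in> S" "t < s" using t(2) less_cSup_iff[of S t] S0 bddS unfolding c_def by auto
    then obtain P Q where "sep s P Q" by (auto simp: S_def)
    then show ?thesis using sep_mono[of s P Q t] t(1) s(2) by auto
  qed
  have near: "\<forall>\<^sub>F x in nhds y. x \<in> closure \<Omega> \<longrightarrow> V x < t" if y: "y \<in> closure \<Omega>" "V y < t" for y t
  proof -
    have "(V \<longlongrightarrow> V y) (at y within closure \<Omega>)" using V y(1) by (simp add: continuous_on)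
    then have "\<forall>\<^sub>F x in at y within closure \<Omega>. V x < t" using y(2) by (rule order_tendstoD)
    then have "\<forall>\<^sub>F x in at y. x \<in> closure \<Omega> \<longrightarrow> V x < t" by (simp add: eventually_at_filter)
    then show ?thesis using y by (simp add: eventually_nhds_conv_at)
  qed
  have off: "\<forall>\<^sub>F x in nhds y. x \<notin> D" if "closed D" "y \<notin> D" for y and D :: "'a set"
    using that eventually_nhds_in_open[of "- D" y] by auto
  have inO: "\<forall>\<^sub>F x in nhds y. x \<in> \<Omega>" if "y \<in> \<Omega>" for y
    using that eventually_nhds_in_open[OF \<Omega>(1)] by auto
  \<comment> \<open>A minimiser y of V on P \<inter> Q' would be a local minimum in \<Omega>: it
    avoids Q and P', hence the frontier, and a nearby lower point lies in both sublevel sets but in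
    neither Q nor P', so it is again in P \<inter> Q'.\<close>
  have uniq: "P \<inter> Q' = {}" if S1: "sep s P Q" and S2: "sep t P' Q'" for s t P Q P' Q'
  proof (rule ccontr)
    assume ne: "P \<inter> Q' \<noteq> {}"
    define R where "R = P \<inter> Q'"
    have "R \<subseteq> closure \<Omega>" "closed R" using S1 S2 by (auto simp: R_def sep_def K_def)
    then have "compact R" using compact_X by (metis compact_Int_closed inf.absorb_iff2)
    moreover have "continuous_on R V" using V \<open>R \<subseteq> closure \<Omega>\<close> by (rule continuous_on_subset)
    ultimately obtain y where y: "y \<in> R" "\<And>x. x \<in> R \<Longrightarrow> V y \<le> V x"
      using continuous_attains_inf[of R V] ne unfolding R_def by blast
    have yn: "y \<notin> Q" "y \<notin> P'" using y(1) S1 S2 by (auto simp: R_def sep_def)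
    then have "y \<notin> A \<union> B" using S1 S2 by (auto simp: sep_def)
    then have yO: "y \<in> \<Omega>" using AB(4) cl y(1) \<open>R \<subseteq> closure \<Omega>\<close> by auto
    have yK: "V y \<le> s" "V y \<le> t" using y(1) S1 S2 by (auto simp: R_def sep_def K_def)
    have "\<forall>\<^sub>F x in nhds y. V y \<le> V x"
    proof -
      have "\<forall>\<^sub>F x in nhds y. x \<notin> Q \<and> x \<notin> P' \<and> x \<in> \<Omega>"
        using off[OF _ yn(1)] off[OF _ yn(2)] inO[OF yO] S1 S2
        by (auto simp: sep_def intro: eventually_conj)
      then show ?thesis
      proof (rule eventually_mono)
        fix x assume x: "x \<notin> Q \<and> x \<notin> P' \<and> x \<in> \<Omega>"
        show "V y \<le> V x"
        proof (rule ccontr)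
          assume "\<not> V y \<le> V x"
          then have "x \<in> K s" "x \<in> K t" using x yK cl by (auto simp: K_def)
          then have "x \<in> R" using x S1 S2 by (auto simp: sep_def R_def)
          then show False using y(2) \<open>\<not> V y \<le> V x\<close> by blast
        qed
      qed
    qed
    then show False using nomin[OF yO] by blast
  qed
  \<comment> \<open>The sides are collected over all levels below c, since no separation exists at
    level c itself; \<open>uniq\<close> makes the two collections disjoint.\<close>
  define E where "E = {x \<in> \<Omega>. \<exists>s P Q. s < c \<and> sep s P Q \<and> x \<in> P}"
  define F where "F = {x \<in> \<Omega>. \<exists>s P Q. s < c \<and> sep s P Q \<and> x \<in> Q}"
  have EF0: "E \<inter> F = {}" using uniq by (fastforce simp: E_def F_def)
  have EF: "E \<union> F = {x\<in>\<Omega>. V x < c}"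
  proof
    show "E \<union> F \<subseteq> {x\<in>\<Omega>. V x < c}" by (force simp: E_def F_def sep_def K_def)
    show "{x\<in>\<Omega>. V x < c} \<subseteq> E \<union> F"
    proof
      fix x assume x: "x \<in> {x\<in>\<Omega>. V x < c}"
      then obtain P Q where PQ: "sep (V x) P Q" using ex_sep[of "V x"] Vpos[of x] by force
      then have "x \<in> P \<union> Q" using x cl by (auto simp: sep_def K_def)
      then show "x \<in> E \<union> F" using x PQ unfolding E_def F_def by blast
    qed
  qed
  \<comment> \<open>Taking y in P and not just in E admits points of the frontier: with the
    separation of level 0 this keeps \<open>closure F\<close> away from A.\<close>
  have nearE: "\<forall>\<^sub>F x in nhds y. x \<in> \<Omega> \<longrightarrow> x \<in> E" if "sep s P Q" "s < c" "y \<in> P" for y s P Q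
  proof -
    have "y \<in> K s" using that by (auto simp: sep_def)
    then have yX: "y \<in> closure \<Omega>" "V y < c" using that(2) by (auto simp: K_def)
    obtain t where t: "V y < t" "t < c" using yX(2) dense by blast
    then have "0 \<le> t" using V_nonneg[OF yX(1)] by simp
    then obtain P' Q' where S': "sep t P' Q'" using ex_sep t by blast
    have "y \<notin> Q'" using uniq[OF that(1) S'] that(3) by blast
    moreover have "closed Q'" using S' by (simp add: sep_def)
    ultimately have "\<forall>\<^sub>F x in nhds y. x \<notin> Q' \<and> (x \<in> closure \<Omega> \<longrightarrow> V x < t)"
      using off near[OF yX(1) t(1)] by (intro eventually_conj) auto
    then show ?thesis
    proof (rule eventually_mono, intro impI)
      fix x assume x: "x \<notin> Q' \<and> (x \<in> closure \<Omega> \<longrightarrow> V x < t)" "x \<in> \<Omega>"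
      then have "x \<in> K t" using cl by (auto simp: K_def)
      then have "x \<in> P'" using x S' by (auto simp: sep_def)
      then show "x \<in> E" using x S' t by (auto simp: E_def)
    qed
  qed
  have nearF: "\<forall>\<^sub>F x in nhds y. x \<in> \<Omega> \<longrightarrow> x \<in> F" if "sep s P Q" "s < c" "y \<in> Q" for y s P Q
  proof -
    have "y \<in> K s" using that by (auto simp: sep_def)
    then have yX: "y \<in> closure \<Omega>" "V y < c" using that(2) by (auto simp: K_def)
    obtain t where t: "V y < t" "t < c" using yX(2) dense by blast
    then have "0 \<le> t" using V_nonneg[OF yX(1)] by simp
    then obtain P' Q' where S': "sep t P' Q'" using ex_sep t by blast
    have "y \<notin> P'" using uniq[OF S' that(1)] that(3) by blast
    moreover have "closed P'" using S' by (simp add: sep_def)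
    ultimately have "\<forall>\<^sub>F x in nhds y. x \<notin> P' \<and> (x \<in> closure \<Omega> \<longrightarrow> V x < t)"
      using off near[OF yX(1) t(1)] by (intro eventually_conj) auto
    then show ?thesis
    proof (rule eventually_mono, intro impI)
      fix x assume x: "x \<notin> P' \<and> (x \<in> closure \<Omega> \<longrightarrow> V x < t)" "x \<in> \<Omega>"
      then have "x \<in> K t" using cl by (auto simp: K_def)
      then have "x \<in> Q'" using x S' by (auto simp: sep_def)
      then show "x \<in> F" using x S' t by (auto simp: F_def)
    qed
  qed
  have opE: "open E"
  proof (subst open_subopen, intro ballI)
    fix x assume x: "x \<in> E"
    then have "\<forall>\<^sub>F y in nhds x. y \<in> \<Omega> \<and> (y \<in> \<Omega> \<longrightarrow> y \<in> E)"
      using nearE inO[of x] by (intro eventually_conj) (auto simp: E_def)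
    then show "\<exists>T. open T \<and> x \<in> T \<and> T \<subseteq> E" unfolding eventually_nhds by blast
  qed
  have opF: "open F"
  proof (subst open_subopen, intro ballI)
    fix x assume x: "x \<in> F"
    then have "\<forall>\<^sub>F y in nhds x. y \<in> \<Omega> \<and> (y \<in> \<Omega> \<longrightarrow> y \<in> F)"
      using nearF inO[of x] by (intro eventually_conj) (auto simp: F_def)
    then show "\<exists>T. open T \<and> x \<in> T \<and> T \<subseteq> F" unfolding eventually_nhds by blast
  qed
  have notcl: "x \<notin> closure D" if "\<forall>\<^sub>F y in nhds x. y \<notin> D" for x and D :: "'a set"
    using that unfolding eventually_nhds closure_iff_nhds_not_empty by blast
  have AF: "A \<inter> closure F = {}"
  proof -
    have "x \<notin> closure F" if "x \<in> A" for x
      using nearE[OF sep0 c0 that] by (intro notcl, elim eventually_mono) (use EF0 in \<open>auto simp: F_def\<close>)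
    then show ?thesis by blast
  qed
  have BE: "B \<inter> closure E = {}"
  proof -
    have "x \<notin> closure E" if "x \<in> B" for x
      using nearF[OF sep0 c0 that] by (intro notcl, elim eventually_mono) (use EF0 in \<open>auto simp: E_def\<close>)
    then show ?thesis by blast
  qed
  have EFsub: "closure E \<subseteq> K c" "closure F \<subseteq> K c"
  proof -
    have "E \<union> F \<subseteq> K c" unfolding EF using cl(1) by (auto simp: K_def)
    then show "closure E \<subseteq> K c" "closure F \<subseteq> K c" 
      using closure_minimal[OF _ closed_K[of c]] by blast+
  qed
  \<comment> \<open>Otherwise the two closures, joined with A and B, would separate the sublevel set
    of c. They cover it, because a point of \<Omega> at level c outside both closures would be a
    local minimum.\<close>
  have meet: "closure E \<inter> closure F \<noteq> {}"
  proof
    assume d: "closure E \<inter> closure F = {}"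
    have "K c \<subseteq> (A \<union> closure E) \<union> (B \<union> closure F)"
    proof
      fix x assume x: "x \<in> K c"
      show "x \<in> (A \<union> closure E) \<union> (B \<union> closure F)"
      proof (cases "x \<in> frontier \<Omega>")
        case True
        then show ?thesis using AB(4) by auto
      next
        case False
        then have xO: "x \<in> \<Omega>" using x cl by (auto simp: K_def)
        have "x \<in> closure (E \<union> F)"
        proof (rule ccontr)
          assume "x \<notin> closure (E \<union> F)"
          then have "\<forall>\<^sub>F y in nhds x. y \<notin> closure (E \<union> F) \<and> y \<in> \<Omega>"
            by (intro eventually_conj off inO xO closed_closure)
          then have "\<forall>\<^sub>F y in nhds x. V x \<le> V y"
          proof (rule eventually_mono)
            fix y assume y: "y \<notin> closure (E \<union> F) \<and> y \<in> \<Omega>"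
            then have "y \<notin> E \<union> F" using closure_subset by blast
            then have "\<not> V y < c" unfolding EF using y by blast
            then show "V x \<le> V y" using x by (simp add: K_def)
          qed
          then show False using nomin[OF xO] by blast
        qed
        then show ?thesis by auto
      qed
    qed
    then have "sep c (A \<union> closure E) (B \<union> closure F)"
      using AB(1,2,3) AF BE d EFsub frK[of c] c0 unfolding sep_def by (auto simp: closed_Un)
    then show False using notc by blast
  qed
  have "closure E \<inter> closure F \<subseteq> \<Omega>"
    using EFsub AF BE AB(4) cl by (auto simp: K_def)
  then show thesis using that[OF c0 opE opF EF0 EF meet] by blast
qed

section \<open>The differential inequality for \<open>C\<^sup>1\<close> solutions\<close>

lemma C2_data_translate:
  assumes "C2_data UNIV f g H"
  shows "C2_data UNIV (\<lambda>x. f (x - p)) (\<lambda>x. g (x - p)) (\<lambda>x. H (x - p))"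
proof -
  have sh: "((\<lambda>x. x - p) has_derivative (\<lambda>v. v)) (at x)" for x :: 'a
    by (auto intro!: derivative_eq_intros)
  have "continuous_on UNIV (\<lambda>x. H (x - p) v)" for v
    by (rule continuous_on_compose2[OF C2_dataD(5)[OF assms]]) (auto intro!: continuous_intros)
  then show ?thesis
    using has_derivative_compose[OF sh C2_dataD(2)[OF assms UNIV_I]]
      has_derivative_compose[OF sh C2_dataD(3)[OF assms UNIV_I]] C2_dataD(4)[OF assms UNIV_I]
    unfolding C2_data_def by auto
qed

lemma gradient_eq_at_touching:
  assumes S: "open S" "x \<in> S"
    and f: "(f has_derivative (\<lambda>v. a \<bullet> v)) (at x)" and h: "(h has_derivative (\<lambda>v. b \<bullet> v)) (at x)"
    and le: "\<And>y. y \<in> S \<Longrightarrow> f y \<le> h y" and eq: "f x = h x"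
  shows "a = (b :: 'a::euclidean_space)"
proof -
  have "((\<lambda>x. f x - h x) has_derivative (\<lambda>v. a \<bullet> v - b \<bullet> v)) (at x)" by (rule has_derivative_diff[OF f h])
  then have "(\<lambda>v. a \<bullet> v - b \<bullet> v) = (\<lambda>v. 0)"
    by (rule differential_zero_maxmin[OF S(2,1)]) (use le eq in auto)
  then have "(a - b) \<bullet> (a - b) = 0" by (metis inner_diff_left)
  then show ?thesis by simp
qed

locale C1_subsolution =
  fixes \<Omega> :: "(real^'n::finite) set" and k :: nat and u :: "real^'n \<Rightarrow> real" and R :: real
  assumes n: "CARD('n) \<ge> 3" and k: "2 \<le> k"
    and \<Omega>: "open \<Omega>" and R: "R > 0" "\<And>x. x \<in> \<Omega> \<Longrightarrow> norm x \<le> R"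
    and u: "viscosity_solution k \<Omega> u" and C1: "Ck_on 1 \<Omega> u"
begin

text \<open>For |x| \<le> R this makes |2 \<epsilon> x|^2 at most \<epsilon> / 2. With a test
  gradient of squared norm at most \<epsilon> / 2, the full gradient term then costs at most (n - 1)
  \<epsilon>, half of the 2 (n - 1) \<epsilon> gained from the Hessian of \<epsilon> |x|^2.\<close>

definition \<epsilon> :: real where "\<epsilon> = 1 / (8 * R\<^sup>2)"

lemma eps: "\<epsilon> > 0" "8 * \<epsilon> * R\<^sup>2 = 1"
  using R by (auto simp: \<epsilon>_def)

text \<open>Writing \<open>u = exp ((n - 2) / 2 * w)\<close>, this is \<open>exp (- w - \<epsilon> |x|\<^sup>2)\<close>. The term
  \<open>\<epsilon> |x|\<^sup>2\<close> makes the differential inequality strict wherever the gradient is small.\<close>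

definition V :: "real^'n \<Rightarrow> real" where
  "V x = (if x \<in> \<Omega> then exp (- (2 / (real CARD('n) - 2)) * ln (u x) - \<epsilon> * (norm x)\<^sup>2) else 0)"

text \<open>The gradient of V in \<Omega>, written out so that its continuity can be read off from
  that of u and its gradient.\<close>

definition GV :: "real^'n \<Rightarrow> real^'n" where
  "GV x = - V x *\<^sub>R ((2 / (real CARD('n) - 2) / u x) *\<^sub>R grad u x + (2 * \<epsilon>) *\<^sub>R x)"

lemma u_pos: "x \<in> \<Omega> \<Longrightarrow> u x > 0" using u by (simp add: viscosity_solution_def)

lemma V_pos: "x \<in> \<Omega> \<Longrightarrow> V x > 0" by (simp add: V_def)

lemma V_nonneg: "V x \<ge> 0" by (simp add: V_def)

lemma u_eq_V: "x \<in> \<Omega> \<Longrightarrow> u x = exp ((real CARD('n) - 2) / 2 * (- ln (V x) - \<epsilon> * (norm x)\<^sup>2))"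
  using n u_pos[of x] by (simp add: V_def)

lemma V_has_derivative:
  assumes x: "x \<in> \<Omega>"
  shows "(V has_derivative (\<lambda>v. GV x \<bullet> v)) (at x)"
proof -
  let ?c = "2 / (real CARD('n) - 2)"
  have "u differentiable at x" using C1 x by simp
  then have D: "(u has_derivative frechet_derivative u (at x)) (at x)"
    by (simp add: frechet_derivative_works)
  have lin: "linear (frechet_derivative u (at x))" using D by (rule has_derivative_linear)
  have "frechet_derivative u (at x) v = grad u x \<bullet> v" for v
  proof -
    have "v = (\<Sum>i\<in>UNIV. v $ i *\<^sub>R axis i 1)"
      by (simp add: vec_eq_iff axis_def if_distrib cong: if_cong)
    then have "frechet_derivative u (at x) v = frechet_derivative u (at x) (\<Sum>i\<in>UNIV. v $ i *\<^sub>R axis i 1)"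
      by (rule arg_cong)
    also have "\<dots> = (\<Sum>i\<in>UNIV. v $ i * frechet_derivative u (at x) (axis i 1))"
      by (simp add: linear_sum[OF lin] linear_cmul[OF lin])
    finally show ?thesis by (simp add: grad_def partial_deriv_def inner_vec_def mult.commute)
  qed
  then have "frechet_derivative u (at x) = (\<lambda>v. grad u x \<bullet> v)" by (rule ext)
  with D have du: "(u has_derivative (\<lambda>v. grad u x \<bullet> v)) (at x)" by (simp only:)
  note nd = C2_dataD(2)[OF C2_data_norm_sq UNIV_I, of x]
  have Vx: "V x = exp (- ?c * ln (u x) - \<epsilon> * (norm x)\<^sup>2)" using x by (simp add: V_def)
  have "((\<lambda>x. exp (- ?c * ln (u x) - \<epsilon> * (norm x)\<^sup>2)) has_derivative (\<lambda>v. GV x \<bullet> v)) (at x)"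
    by (rule has_derivative_eq_rhs)
      (auto intro!: derivative_eq_intros du nd u_pos x
        simp: GV_def Vx fun_eq_iff inner_add_left algebra_simps divide_inverse)
  then show ?thesis
    by (rule has_derivative_transform_within_open[OF _ \<Omega> x]) (simp add: V_def)
qed

lemma continuous_on_V: "continuous_on \<Omega> V"
  using V_has_derivative has_derivative_continuous continuous_at_imp_continuous_on by blast

lemma continuous_on_GV: "continuous_on \<Omega> GV"
proof -
  have uc: "continuous_on \<Omega> u" using u by (simp add: viscosity_solution_def)
  have "continuous_on \<Omega> (partial_deriv i u)" for i using C1 by simp
  then have "continuous_on \<Omega> (grad u)" unfolding grad_def[abs_def] by (intro continuous_on_vec_lambda)
  moreover have "\<forall>x\<in>\<Omega>. u x \<noteq> 0" using u_pos by force
  ultimately show ?thesis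
    unfolding GV_def[abs_def] by (intro continuous_intros continuous_on_V uc)
qed

text \<open>Below V the function exp (- \<omega>) corresponds to a test function for u from above
  with logarithm proportional to \<omega> - \<epsilon> |x|^2. Expanding its squared derivatives
  leaves the cross terms between g and y, which are kept because they become small only where g is
  nearly orthogonal to B.\<close>

lemma touching_from_below:
  assumes B: "frame e B" and om: "C2_data U \<omega> g H" and y: "y \<in> U" "y \<in> \<Omega>"
    and eq: "V y = exp (- \<omega> y)" and ge: "\<forall>\<^sub>F x in nhds y. V x \<ge> exp (- \<omega> x)"
    and small: "(norm (g y))\<^sup>2 \<le> \<epsilon> / 2"
  shows "(\<Sum>b\<in>B. H y b \<bullet> b - (g y \<bullet> b)\<^sup>2 + 4 * \<epsilon> * ((g y \<bullet> b) * (y \<bullet> b))) \<ge> (real CARD('n) - 1) * \<epsilon>"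
proof -
  interpret frame e B by fact
  let ?n = "real CARD('n)"
  have cB: "real (card B) = ?n - 1" using card_B by simp
  have C: "C2_data U (\<lambda>x. \<omega> x + (- \<epsilon>) * (norm x)\<^sup>2) (\<lambda>x. g x + (- \<epsilon>) *\<^sub>R 2 *\<^sub>R x) (\<lambda>x v. H x v + (- \<epsilon>) *\<^sub>R 2 *\<^sub>R v)"
    by (rule C2_data_add[OF om C2_data_subset[OF C2_data_cmult[OF C2_data_norm_sq] C2_dataD(1)[OF om]]]) simp
  have e1: "u y = exp ((?n - 2) / 2 * (\<omega> y + (- \<epsilon>) * (norm y)\<^sup>2))"
    using u_eq_V[OF y(2)] eq by simp
  have "\<forall>\<^sub>F x in nhds y. x \<in> \<Omega>" using \<Omega> y(2) by (rule eventually_nhds_in_open)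
  with ge have le: "\<forall>\<^sub>F x in nhds y. u x \<le> exp ((?n - 2) / 2 * (\<omega> x + (- \<epsilon>) * (norm x)\<^sup>2))"
  proof eventually_elim
    case (elim x)
    have "- \<omega> x \<le> ln (V x)" using elim V_pos[of x] by (simp add: ln_ge_iff)
    then show ?case using n u_eq_V[OF elim(2)] by (simp add: mult_left_mono)
  qed
  from viscosity_subsolution_trace[OF n k u y(2) C y(1) e1 le orth unit sp notin]
  have *: "0 < (\<Sum>b\<in>B. (H y b + (- \<epsilon>) *\<^sub>R 2 *\<^sub>R b) \<bullet> b - ((g y + (- \<epsilon>) *\<^sub>R 2 *\<^sub>R y) \<bullet> b)\<^sup>2)
      + (?n - 1) / 2 * (norm (g y + (- \<epsilon>) *\<^sub>R 2 *\<^sub>R y))\<^sup>2" .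
  have "(norm (g y + (- \<epsilon>) *\<^sub>R 2 *\<^sub>R y))\<^sup>2 \<le> 2 * \<epsilon>"
  proof -
    have yR: "(norm y)\<^sup>2 \<le> R\<^sup>2" using R y(2) by (intro power_mono) auto
    have "norm (g y + (- \<epsilon>) *\<^sub>R 2 *\<^sub>R y) \<le> norm (g y) + 2 * \<epsilon> * norm y"
      using norm_triangle_ineq[of "g y" "(- \<epsilon>) *\<^sub>R 2 *\<^sub>R y"] eps by simp
    then have "(norm (g y + (- \<epsilon>) *\<^sub>R 2 *\<^sub>R y))\<^sup>2 \<le> (norm (g y) + 2 * \<epsilon> * norm y)\<^sup>2"
      by (intro power_mono) auto
    also have "\<dots> \<le> 2 * (norm (g y))\<^sup>2 + 2 * (2 * \<epsilon> * norm y)\<^sup>2"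
      using sum_squares_bound[of "norm (g y)" "2 * \<epsilon> * norm y"] by (simp add: power2_sum)
    also have "(2 * \<epsilon> * norm y)\<^sup>2 \<le> (2 * \<epsilon>)\<^sup>2 * R\<^sup>2"
      unfolding power_mult_distrib[of "2 * \<epsilon>"] by (intro mult_left_mono yR) simp
    also have "(2 * \<epsilon>)\<^sup>2 * R\<^sup>2 = \<epsilon> / 2"
    proof -
      have "(2 * \<epsilon>)\<^sup>2 * R\<^sup>2 = \<epsilon> / 2 * (8 * \<epsilon> * R\<^sup>2)" by (simp add: power2_eq_square)
      then show ?thesis unfolding eps(2) by simp
    qed
    finally show ?thesis using small by simp
  qed
  then have "(?n - 1) / 2 * (norm (g y + (- \<epsilon>) *\<^sub>R 2 *\<^sub>R y))\<^sup>2 \<le> (?n - 1) / 2 * (2 * \<epsilon>)"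
    using n by (intro mult_left_mono) auto
  moreover have "(\<Sum>b\<in>B. (H y b + (- \<epsilon>) *\<^sub>R 2 *\<^sub>R b) \<bullet> b - ((g y + (- \<epsilon>) *\<^sub>R 2 *\<^sub>R y) \<bullet> b)\<^sup>2)
      \<le> (\<Sum>b\<in>B. (H y b \<bullet> b - (g y \<bullet> b)\<^sup>2 + 4 * \<epsilon> * ((g y \<bullet> b) * (y \<bullet> b))) - 2 * \<epsilon>)"
  proof (rule sum_mono)
    fix b assume b: "b \<in> B"
    have "((g y + (- \<epsilon>) *\<^sub>R 2 *\<^sub>R y) \<bullet> b)\<^sup>2
        = (g y \<bullet> b)\<^sup>2 - 4 * \<epsilon> * ((g y \<bullet> b) * (y \<bullet> b)) + (2 * \<epsilon> * (y \<bullet> b))\<^sup>2"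
      by (simp add: inner_add_left power2_eq_square algebra_simps)
    moreover have "0 \<le> (2 * \<epsilon> * (y \<bullet> b))\<^sup>2" by simp
    moreover have "(H y b + (- \<epsilon>) *\<^sub>R 2 *\<^sub>R b) \<bullet> b = H y b \<bullet> b - 2 * \<epsilon>"
      using inner_B[OF b b] by (simp add: inner_add_left inner_diff_left)
    ultimately show "(H y b + (- \<epsilon>) *\<^sub>R 2 *\<^sub>R b) \<bullet> b - ((g y + (- \<epsilon>) *\<^sub>R 2 *\<^sub>R y) \<bullet> b)\<^sup>2
        \<le> (H y b \<bullet> b - (g y \<bullet> b)\<^sup>2 + 4 * \<epsilon> * ((g y \<bullet> b) * (y \<bullet> b))) - 2 * \<epsilon>"
      by linarith
  qed
  moreover have "(\<Sum>b\<in>B. (H y b \<bullet> b - (g y \<bullet> b)\<^sup>2 + 4 * \<epsilon> * ((g y \<bullet> b) * (y \<bullet> b))) - 2 * \<epsilon>)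
      = (\<Sum>b\<in>B. H y b \<bullet> b - (g y \<bullet> b)\<^sup>2 + 4 * \<epsilon> * ((g y \<bullet> b) * (y \<bullet> b))) - (?n - 1) * (2 * \<epsilon>)"
    by (simp add: sum_subtractf cB)
  moreover have "(?n - 1) / 2 * (2 * \<epsilon>) = (?n - 1) * \<epsilon>" "(?n - 1) * (2 * \<epsilon>) = 2 * ((?n - 1) * \<epsilon>)"
    by simp_all
  ultimately show ?thesis using * by linarith
qed

lemma ex_frame:
  assumes "norm (e :: real^'n) = 1"
  obtains B where "frame e B"
proof -
  obtain S where S: "e \<in> S" "pairwise orthogonal S" "\<And>x. x \<in> S \<Longrightarrow> norm x = 1" "span S = UNIV"
    using vector_in_orthonormal_basis[OF assms] by metis
  have "insert e (S - {e}) = S" using S(1) by auto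
  then have "frame e (S - {e})" using S by unfold_locales auto
  then show thesis by (rule that)
qed

text \<open>At a local minimum a constant touches V from below; its gradient and Hessian vanish,
  against the strict positivity gained from \<epsilon>. The normal e may be any unit vector.\<close>

lemma V_no_local_min:
  assumes y: "y \<in> \<Omega>"
  shows "\<not> (\<forall>\<^sub>F x in nhds y. V y \<le> V x)"
proof
  assume min: "\<forall>\<^sub>F x in nhds y. V y \<le> V x"
  have "norm (axis undefined 1 :: real^'n) = 1" by simp
  then obtain B where B: "frame (axis undefined 1 :: real^'n) B" by (rule ex_frame)
  have "(real CARD('n) - 1) * \<epsilon> \<le> 0"
    using touching_from_below[OF B C2_data_const[of "- ln (V y)"] UNIV_I y] min V_pos[OF y] eps(1) by simp
  moreover have "(real CARD('n) - 1) * \<epsilon> > 0" using n eps by simp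
  ultimately show False by simp
qed

text \<open>If \<Psi> touches ln (c - V) from above, then c - exp \<Psi> touches V from below, so
  \<omega> = - ln (c - exp \<Psi>) is admissible in \<open>touching_from_below\<close>. With a = (c
  - V) / V its Hessian is a H + (a + a^2) g g^T; the a^2 part cancels against the squared derivative
  of \<omega>, and a times the squared derivative of \<Psi> is left. Along B this is small by
  \<open>gB\<close> and continuity.\<close>

lemma log_strictly_subharmonic:
  assumes B: "frame e B" and c: "c > 0" and p: "p \<in> \<Omega>" "c / 2 < V p" "V p < c"
    and gs: "norm (GV p) < c / 2 * sqrt (\<epsilon> / 2)" and gB: "\<And>b. b \<in> B \<Longrightarrow> GV p \<bullet> b = 0"
  shows "\<exists>r>0. \<forall>\<rho>. 0 < \<rho> \<longrightarrow> \<rho> \<le> r \<longrightarrow>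
    frame.strictly_subharmonic_viscosity B (\<epsilon> / 4) \<rho> (\<lambda>v. ln (c - V (p + v)))"
proof -
  interpret frame e B by fact
  \<comment> \<open>A bound for the derivatives of ln (c - V) along B near p, chosen so that the
    error s^2 + 4 \<epsilon> s (x . b) is at most \<epsilon> / 8. The cap 1 replaces \<mu> + 4
    \<epsilon> R by 1 + 4 \<epsilon> R.\<close>
  define \<mu> where "\<mu> = min 1 (\<epsilon> / (8 * (1 + 4 * \<epsilon> * R)))"
  have q: "1 + 4 * \<epsilon> * R > 0" using eps R by (simp add: add_pos_pos)
  have \<mu>: "\<mu> > 0" "\<mu> * (\<mu> + 4 * \<epsilon> * R) \<le> \<epsilon> / 8"
  proof -
    show "\<mu> > 0" using q eps by (simp add: \<mu>_def)
    then have "\<mu> * (\<mu> + 4 * \<epsilon> * R) \<le> \<mu> * (1 + 4 * \<epsilon> * R)" by (intro mult_left_mono) (auto simp: \<mu>_def)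
    also have "\<dots> \<le> \<epsilon> / (8 * (1 + 4 * \<epsilon> * R)) * (1 + 4 * \<epsilon> * R)"
      using q by (intro mult_right_mono) (auto simp: \<mu>_def)
    also have "\<dots> = \<epsilon> / 8"
    proof -
      have "\<epsilon> / (8 * w) * w = \<epsilon> / 8" if "w > 0" for w using that by simp
      then show ?thesis using q by blast
    qed
    finally show "\<mu> * (\<mu> + 4 * \<epsilon> * R) \<le> \<epsilon> / 8" .
  qed
  have isV: "isCont V p" and isG: "isCont GV p"
    using continuous_on_V continuous_on_GV \<Omega> p(1) by (auto simp: continuous_on_eq_continuous_at)
  have tV: "(V \<longlongrightarrow> V p) (nhds p)" and tG: "(GV \<longlongrightarrow> GV p) (nhds p)"
    using isV isG by (simp_all add: isCont_def tendsto_at_iff_tendsto_nhds)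
  have "\<forall>\<^sub>F x in nhds p. x \<in> \<Omega>" using \<Omega> p(1) by (rule eventually_nhds_in_open)
  moreover have "\<forall>\<^sub>F x in nhds p. c / 2 < V x" "\<forall>\<^sub>F x in nhds p. V x < c"
    by (rule order_tendstoD[OF tV], rule p)+
  moreover have "\<forall>\<^sub>F x in nhds p. norm (GV x) < c / 2 * sqrt (\<epsilon> / 2)"
    by (rule order_tendstoD(2)[OF tendsto_norm[OF tG] gs])
  moreover have "\<forall>\<^sub>F x in nhds p. \<forall>b\<in>B. \<bar>GV x \<bullet> b / (c - V x)\<bar> < \<mu>"
  proof (rule eventually_ball_finite[OF finite_B], rule ballI)
    fix b assume b: "b \<in> B"
    have "((\<lambda>x. \<bar>GV x \<bullet> b / (c - V x)\<bar>) \<longlongrightarrow> \<bar>GV p \<bullet> b / (c - V p)\<bar>) (nhds p)"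
      using p by (intro tendsto_intros tV tG) auto
    then show "\<forall>\<^sub>F x in nhds p. \<bar>GV x \<bullet> b / (c - V x)\<bar> < \<mu>"
      by (rule order_tendstoD) (simp add: gB[OF b] \<mu>)
  qed
  ultimately have "\<forall>\<^sub>F x in nhds p. x \<in> \<Omega> \<and> c / 2 < V x \<and> V x < c \<and>
      norm (GV x) < c / 2 * sqrt (\<epsilon> / 2) \<and> (\<forall>b\<in>B. \<bar>GV x \<bullet> b / (c - V x)\<bar> < \<mu>)"
    by eventually_elim blast
  then obtain d where d: "d > 0" and near: "\<And>x. dist x p < d \<Longrightarrow> x \<in> \<Omega> \<and> c / 2 < V x \<and> V x < c \<and>
      norm (GV x) < c / 2 * sqrt (\<epsilon> / 2) \<and> (\<forall>b\<in>B. \<bar>GV x \<bullet> b / (c - V x)\<bar> < \<mu>)"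
    unfolding eventually_nhds_metric by blast
  have "strictly_subharmonic_viscosity (\<epsilon> / 4) \<rho> (\<lambda>v. ln (c - V (p + v)))" if \<rho>: "0 < \<rho>" "\<rho> \<le> d / 2" for \<rho>
    unfolding strictly_subharmonic_viscosity_def
  proof (intro conjI allI impI)
    have nv: "p + v \<in> \<Omega> \<and> c / 2 < V (p + v) \<and> V (p + v) < c \<and>
      norm (GV (p + v)) < c / 2 * sqrt (\<epsilon> / 2) \<and> (\<forall>b\<in>B. \<bar>GV (p + v) \<bullet> b / (c - V (p + v))\<bar> < \<mu>)"
      if "v \<in> cball 0 \<rho>" for v
    proof (rule near)
      show "dist (p + v) p < d" using that \<rho> d by (simp add: dist_norm)
    qed
    have "continuous_on (cball 0 \<rho>) (\<lambda>v. V (p + v))"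
    proof (rule continuous_on_compose2[OF continuous_on_V])
      show "(\<lambda>v. p + v) ` cball 0 \<rho> \<subseteq> \<Omega>" by (rule image_subsetI) (use nv in blast)
    qed (intro continuous_intros)
    then show "continuous_on (cball 0 \<rho>) (\<lambda>v. ln (c - V (p + v)))"
      by (intro continuous_intros) (use nv in force)+
    fix \<Psi> g H y
    assume "C2_data UNIV \<Psi> g H \<and> y \<in> ball 0 \<rho> \<and>
      (\<forall>x\<in>cball 0 \<rho>. ln (c - V (p + x)) \<le> \<Psi> x) \<and> ln (c - V (p + y)) = \<Psi> y"
    then have \<Psi>: "C2_data UNIV \<Psi> g H" and y: "y \<in> ball 0 \<rho>"
      and le: "\<And>x. x \<in> cball 0 \<rho> \<Longrightarrow> ln (c - V (p + x)) \<le> \<Psi> x" and eq: "ln (c - V (p + y)) = \<Psi> y"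
      by auto
    define z where "z = c - V (p + y)"
    define x where "x = p + y"
    have x: "x \<in> \<Omega>" "c / 2 < V x" "V x < c" "norm (GV x) < c / 2 * sqrt (\<epsilon> / 2)"
        "\<And>b. b \<in> B \<Longrightarrow> \<bar>GV x \<bullet> b / (c - V x)\<bar> < \<mu>"
      using nv[of y] y unfolding x_def by auto
    have z: "z > 0" "z \<le> V x" using x by (auto simp: z_def x_def)
    have ez: "exp (\<Psi> y) = z" using z eq by (simp add: z_def[symmetric] flip: eq)
    have gy: "- (1 / z) *\<^sub>R GV x = g y"
    proof (rule gradient_eq_at_touching[OF open_ball y])
      have sh: "((\<lambda>v. p + v) has_derivative (\<lambda>v. v)) (at y)" by (auto intro!: derivative_eq_intros)
      have "((\<lambda>v. V (p + v)) has_derivative (\<lambda>v. GV x \<bullet> v)) (at y)"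
        using has_derivative_compose[OF sh V_has_derivative[of "p + y"]] x by (simp add: x_def)
      then show "((\<lambda>v. ln (c - V (p + v))) has_derivative (\<lambda>v. (- (1 / z) *\<^sub>R GV x) \<bullet> v)) (at y)"
        using z by (auto intro!: derivative_eq_intros simp: z_def x_def fun_eq_iff divide_inverse)
      show "(\<Psi> has_derivative (\<lambda>v. g y \<bullet> v)) (at y)" using C2_dataD(2)[OF \<Psi>] by simp
      show "ln (c - V (p + w)) \<le> \<Psi> w" if "w \<in> ball 0 \<rho>" for w using le that by auto
    qed (rule eq)
    note \<Psi>' = C2_data_translate[OF \<Psi>, of p]
    \<comment> \<open>The region where the logarithm of c - exp \<Psi> is that of a positive number;
      it contains the touching point, as V is positive there.\<close>
    define U where "U = {x. exp (\<Psi> (x - p)) < c}"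
    have opU: "open U" unfolding U_def
      by (intro open_Collect_less continuous_intros C2_dataD(6)[OF \<Psi>'])
    have xU: "x \<in> U" using ez x by (simp add: U_def x_def z_def)
    have om: "C2_data U (\<lambda>x. - ln (c - exp (\<Psi> (x - p))))
       (\<lambda>x. (exp (\<Psi> (x - p)) / (c - exp (\<Psi> (x - p)))) *\<^sub>R g (x - p))
       (\<lambda>x v. (exp (\<Psi> (x - p)) / (c - exp (\<Psi> (x - p)))) *\<^sub>R H (x - p) v
         + ((exp (\<Psi> (x - p)) / (c - exp (\<Psi> (x - p))) + (exp (\<Psi> (x - p)) / (c - exp (\<Psi> (x - p))))\<^sup>2)
             * (g (x - p) \<bullet> v)) *\<^sub>R g (x - p))"
    proof (rule C2_data_compose[OF C2_data_subset[OF \<Psi>' opU subset_UNIV],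
          where F = "\<lambda>s. - ln (c - exp s)" and F' = "\<lambda>s. exp s / (c - exp s)"
          and F'' = "\<lambda>s. exp s / (c - exp s) + (exp s / (c - exp s))\<^sup>2"])
      fix x assume "x \<in> U"
      then have pos: "c - exp (\<Psi> (x - p)) > 0" by (simp add: U_def)
      show "((\<lambda>s. - ln (c - exp s)) has_real_derivative exp (\<Psi> (x - p)) / (c - exp (\<Psi> (x - p)))) (at (\<Psi> (x - p)))"
        using pos by (auto intro!: derivative_eq_intros simp: field_simps)
      show "((\<lambda>s. exp s / (c - exp s)) has_real_derivative
          exp (\<Psi> (x - p)) / (c - exp (\<Psi> (x - p))) + (exp (\<Psi> (x - p)) / (c - exp (\<Psi> (x - p))))\<^sup>2) (at (\<Psi> (x - p)))"
      proof -
        let ?t = "exp (\<Psi> (x - p))"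
        have "((\<lambda>s. exp s / (c - exp s)) has_real_derivative
            (?t * (c - ?t) - ?t * (0 - ?t)) / ((c - ?t) * (c - ?t))) (at (\<Psi> (x - p)))"
          using pos by (intro DERIV_divide derivative_intros) auto
        moreover have "(t * D - t * (0 - t)) / (D * D) = t / D + (t / D)\<^sup>2" if "D > 0" for t D :: real
          using that by (simp add: field_simps power2_eq_square)
        ultimately show ?thesis using pos by simp
      qed
    next
      show "continuous_on ((\<lambda>x. \<Psi> (x - p)) ` U) (\<lambda>s. exp s / (c - exp s) + (exp s / (c - exp s))\<^sup>2)"
        by (intro continuous_intros) (auto simp: U_def)
    qed
    \<comment> \<open>This is exp \<Psi> / (c - exp \<Psi>) at the touching point. It is at most 1
      because V exceeds c / 2.\<close>
    define a where "a = z / V x"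
    have a: "0 < a" "a \<le> 1" using z by (auto simp: a_def)
    have cz: "c - z = V x" by (simp add: z_def x_def)
    have xp: "x - p = y" by (simp add: x_def)
    have "V x = exp (- (- ln (c - exp (\<Psi> (x - p)))))"
      using z cz by (simp add: xp ez)
    moreover have "\<forall>\<^sub>F w in nhds x. exp (- (- ln (c - exp (\<Psi> (w - p))))) \<le> V w"
    proof -
      have "x \<in> ball p \<rho>" using y by (simp add: x_def dist_norm)
      then have "\<forall>\<^sub>F w in nhds x. w \<in> U \<and> w \<in> ball p \<rho>"
        using opU xU by (intro eventually_conj eventually_nhds_in_open) auto
      then show ?thesis
      proof (rule eventually_mono, elim conjE)
        fix w assume w: "w \<in> U" "w \<in> ball p \<rho>"
        then have wc: "w - p \<in> cball 0 \<rho>" by (simp add: dist_norm norm_minus_commute)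
        have pos: "c - V w > 0" using nv[OF wc] by simp
        have "ln (c - V w) \<le> \<Psi> (w - p)" using le[OF wc] by simp
        then have "c - V w \<le> exp (\<Psi> (w - p))" using pos by (metis exp_le_cancel_iff exp_ln)
        then show "exp (- (- ln (c - exp (\<Psi> (w - p))))) \<le> V w" using w(1) by (simp add: U_def)
      qed
    qed
    moreover have "(norm ((exp (\<Psi> (x - p)) / (c - exp (\<Psi> (x - p)))) *\<^sub>R g (x - p)))\<^sup>2 \<le> \<epsilon> / 2"
    proof -
      have "norm ((exp (\<Psi> (x - p)) / (c - exp (\<Psi> (x - p)))) *\<^sub>R g (x - p)) = norm (GV x) / V x"
        unfolding xp ez cz gy[symmetric] using z by simp
      also have "\<dots> \<le> sqrt (\<epsilon> / 2)"
      proof -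
        have "c / 2 * sqrt (\<epsilon> / 2) \<le> V x * sqrt (\<epsilon> / 2)"
          using x eps by (intro mult_right_mono) auto
        then show ?thesis using x(4) z by (simp add: divide_le_eq mult.commute)
      qed
      finally have "(norm ((exp (\<Psi> (x - p)) / (c - exp (\<Psi> (x - p)))) *\<^sub>R g (x - p)))\<^sup>2 \<le> (sqrt (\<epsilon> / 2))\<^sup>2"
        by (rule power_mono) simp
      then show ?thesis using eps by simp
    qed
    ultimately have "(real CARD('n) - 1) * \<epsilon> \<le> (\<Sum>b\<in>B. (a *\<^sub>R H y b + ((a + a\<^sup>2) * (g y \<bullet> b)) *\<^sub>R g y) \<bullet> b
        - ((a *\<^sub>R g y) \<bullet> b)\<^sup>2 + 4 * \<epsilon> * (((a *\<^sub>R g y) \<bullet> b) * (x \<bullet> b)))"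
      using touching_from_below[OF B om xU x(1)] unfolding xp ez cz a_def by blast
    also have "\<dots> \<le> (\<Sum>b\<in>B. a * (H y b \<bullet> b + \<epsilon> / 8))"
    proof (rule sum_mono)
      fix b assume b: "b \<in> B"
      define s where "s = g y \<bullet> b"
      have s: "\<bar>s\<bar> \<le> \<mu>" using x(5)[OF b] by (simp add: s_def gy[symmetric] z_def x_def)
      have xb: "\<bar>x \<bullet> b\<bar> \<le> R"
        using Cauchy_Schwarz_ineq2[of x b] norm_B[OF b] R(2)[OF x(1)] by simp
      have "s\<^sup>2 + 4 * \<epsilon> * (s * (x \<bullet> b)) \<le> \<mu> * (\<mu> + 4 * \<epsilon> * R)"
      proof -
        have "s\<^sup>2 \<le> \<mu>\<^sup>2" using power_mono[OF s, of 2] by simp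
        moreover have "s * (x \<bullet> b) \<le> \<mu> * R"
        proof -
          have "s * (x \<bullet> b) \<le> \<bar>s\<bar> * \<bar>x \<bullet> b\<bar>" by (simp add: abs_mult[symmetric])
          also have "\<dots> \<le> \<mu> * R" using s xb \<mu> by (intro mult_mono) auto
          finally show ?thesis .
        qed
        then have "4 * \<epsilon> * (s * (x \<bullet> b)) \<le> 4 * \<epsilon> * (\<mu> * R)" using eps by (intro mult_left_mono) auto
        ultimately show ?thesis by (simp add: power2_eq_square algebra_simps)
      qed
      then have "s\<^sup>2 + 4 * \<epsilon> * (s * (x \<bullet> b)) \<le> \<epsilon> / 8" using \<mu>(2) by simp
      then have "a * (s\<^sup>2 + 4 * \<epsilon> * (s * (x \<bullet> b))) \<le> a * (\<epsilon> / 8)" using a by (intro mult_left_mono) auto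
      then show "(a *\<^sub>R H y b + ((a + a\<^sup>2) * (g y \<bullet> b)) *\<^sub>R g y) \<bullet> b - ((a *\<^sub>R g y) \<bullet> b)\<^sup>2
          + 4 * \<epsilon> * (((a *\<^sub>R g y) \<bullet> b) * (x \<bullet> b)) \<le> a * (H y b \<bullet> b + \<epsilon> / 8)"
        by (simp add: inner_add_left s_def[symmetric] power2_eq_square algebra_simps)
    qed
    also have "\<dots> = a * ((\<Sum>b\<in>B. H y b \<bullet> b) + (real CARD('n) - 1) * (\<epsilon> / 8))"
      using card_B by (simp add: sum_distrib_left[symmetric] sum.distrib)
    finally have fin: "(real CARD('n) - 1) * \<epsilon> \<le> a * ((\<Sum>b\<in>B. H y b \<bullet> b) + (real CARD('n) - 1) * (\<epsilon> / 8))" .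
    have n1: "(real CARD('n) - 1) * \<epsilon> \<ge> 2 * \<epsilon>" using n eps by (intro mult_right_mono) auto
    let ?S = "(\<Sum>b\<in>B. H y b \<bullet> b) + (real CARD('n) - 1) * (\<epsilon> / 8)"
    \<comment> \<open>The sum must first be known to be positive; only then may the factor a \<le> 1
      be dropped. From n \<ge> 3 the result is at least 7/8 of 2 \<epsilon>, well above \<epsilon> /
      4.\<close>
    have "0 < a * ?S" using fin n1 eps by linarith
    then have "0 < ?S" using a by (simp add: zero_less_mult_iff)
    then have "a * ?S \<le> 1 * ?S" using a by (intro mult_right_mono) auto
    then have "(real CARD('n) - 1) * \<epsilon> \<le> ?S" using fin by simp
    moreover have "(real CARD('n) - 1) * (\<epsilon> / 8) = ((real CARD('n) - 1) * \<epsilon>) / 8" by simp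
    ultimately show "\<epsilon> / 4 < (\<Sum>b\<in>B. H y b \<bullet> b)" using n1 eps(1) by linarith
  qed
  then show ?thesis using d by (intro exI[of _ "d / 2"]) auto
qed

end

section \<open>Nonexistence\<close>

context C1_subsolution
begin

text \<open>The default value 0 of V outside \<Omega> is its limit at the frontier, because u tends
  to infinity there and V is bounded by a negative power of u.\<close>

lemma continuous_on_V_closure:
  assumes blow: "blows_up_at_boundary \<Omega> u"
  shows "continuous_on (closure \<Omega>) V"
  unfolding continuous_on
proof
  fix x assume "x \<in> closure \<Omega>"
  show "(V \<longlongrightarrow> V x) (at x within closure \<Omega>)"
  proof (cases "x \<in> \<Omega>")
    case True
    then have "isCont V x" using continuous_on_V \<Omega> by (simp add: continuous_on_eq_continuous_at)
    then show ?thesis by (meson continuous_at_imp_continuous_at_within continuous_within)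
  next
    case False
    then have fr: "x \<in> frontier \<Omega>"
      using \<open>x \<in> closure \<Omega>\<close> \<Omega> by (simp add: frontier_def interior_open)
    define a where "a = 2 / (real CARD('n) - 2)"
    have a: "a > 0" using n by (simp add: a_def)
    show ?thesis
    proof (rule tendstoI)
      fix r :: real assume r: "r > 0"
      obtain d where d: "d > 0" "\<And>y. y \<in> \<Omega> \<Longrightarrow> infdist y (frontier \<Omega>) < d \<Longrightarrow> u y > exp (- ln r / a)"
        using blow unfolding blows_up_at_boundary_def by metis
      have "V y < r" if "dist y x < d" for y
      proof (cases "y \<in> \<Omega>")
        case True
        have "infdist y (frontier \<Omega>) < d" using infdist_le[OF fr, of y] that by simp
        then have "u y > exp (- ln r / a)" using d(2) True by blast
        then have "- ln r / a < ln (u y)" using u_pos[OF True] by (metis exp_less_cancel_iff exp_ln)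
        then have "a * (- ln r / a) < a * ln (u y)" using a by (intro mult_strict_left_mono)
        then have "- ln r < a * ln (u y)" using a by simp
        moreover have "0 \<le> \<epsilon> * (norm y)\<^sup>2" using eps(1) by simp
        ultimately have "- a * ln (u y) - \<epsilon> * (norm y)\<^sup>2 < ln r" by linarith
        then have "exp (- a * ln (u y) - \<epsilon> * (norm y)\<^sup>2) < exp (ln r)" by (simp only: exp_less_cancel_iff)
        then show ?thesis using True r by (simp add: V_def a_def)
      qed (use r in \<open>simp add: V_def\<close>)
      then have "\<forall>\<^sub>F y in nhds x. V y < r" using d(1) by (auto simp: eventually_nhds_metric)
      then have "\<forall>\<^sub>F y in nhds x. dist (V y) (V x) < r"
        by (rule eventually_mono) (use False V_nonneg in \<open>simp add: V_def dist_real_def\<close>)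
      then show "\<forall>\<^sub>F y in at x within closure \<Omega>. dist (V y) (V x) < r"
        by (simp add: eventually_at_filter eventually_mono)
    qed
  qed
qed

end

text \<open>Near the common point x0 there is a pair at distance below d / 2 with positive value.
  For large N its penalised product exceeds that of any pair at distance at least d, so the
  maximiser is close; its positive value makes both factors positive.\<close>

lemma maximizing_pair:
  fixes z :: "'a::euclidean_space \<Rightarrow> real"
  assumes E: "open E" "bounded E" and F: "open F" "bounded F" and x0: "x0 \<in> closure E" "x0 \<in> closure F"
    and z: "continuous_on (closure E \<union> closure F) z" "\<And>x. x \<in> closure E \<union> closure F \<Longrightarrow> 0 \<le> z x \<and> z x \<le> c"
    and zpos: "\<And>x. x \<in> E \<union> F \<Longrightarrow> z x > 0" and d: "d > 0"
  obtains p q N where "p \<in> closure E" "q \<in> closure F" "z p > 0" "z q > 0" "dist p q < d" "N > 0"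
    "\<And>x y. x \<in> closure E \<Longrightarrow> y \<in> closure F \<Longrightarrow>
      z x * z y * exp (- N * (dist x y)\<^sup>2) \<le> z p * z q * exp (- N * (dist p q)\<^sup>2)"
proof -
  have "\<exists>x\<in>E. dist x x0 < d / 4" "\<exists>y\<in>F. dist y x0 < d / 4"
    using x0 divide_pos_pos[OF d zero_less_numeral] unfolding closure_approachable by blast+
  then obtain x1 y1 where x1: "x1 \<in> E" "dist x1 x0 < d / 4" and y1: "y1 \<in> F" "dist y1 x0 < d / 4"
    by blast
  have cl1: "x1 \<in> closure E" "y1 \<in> closure F" using x1 y1 closure_subset by auto
  have d1: "dist x1 y1 < d / 2" using dist_triangle_half_l[of x1 x0 "d / 2" y1] x1(2) y1(2) by (simp add: dist_commute)
  define a where "a = z x1 * z y1"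
  have a: "a > 0" using zpos x1(1) y1(1) by (simp add: a_def)
  have c: "c > 0" using zpos[of x1] z(2)[of x1] x1(1) cl1(1) by fastforce
  \<comment> \<open>At distance at least d the objective is at most c^2 exp (- N d^2), while the
    chosen pair gives at least a exp (- N d^2 / 4). The gap 3/4 N d^2 has to exceed ln (c^2 / a);
    the absolute value and the 1 also make N positive.\<close>
  define N where "N = (\<bar>ln (c\<^sup>2 / a)\<bar> + 1) / (3 / 4 * d\<^sup>2)"
  have N: "N > 0" using d by (simp add: N_def add_nonneg_pos)
  have Nd: "N * (3 / 4 * d\<^sup>2) = \<bar>ln (c\<^sup>2 / a)\<bar> + 1" using d by (simp add: N_def)
  define G where "G = (\<lambda>w. z (fst w) * z (snd w) * exp (- N * (dist (fst w) (snd w))\<^sup>2))"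
  have "compact (closure E \<times> closure F)" using E F by (intro compact_Times) (auto simp: compact_closure)
  moreover have "closure E \<times> closure F \<noteq> {}" using cl1 by auto
  moreover have "continuous_on (closure E \<times> closure F) G"
  proof -
    have "continuous_on (closure E \<times> closure F) (\<lambda>w. z (fst w))" "continuous_on (closure E \<times> closure F) (\<lambda>w. z (snd w))"
      by (rule continuous_on_compose2[OF z(1) continuous_on_fst[OF continuous_on_id]], force)
         (rule continuous_on_compose2[OF z(1) continuous_on_snd[OF continuous_on_id]], force)
    then show ?thesis unfolding G_def by (intro continuous_intros)
  qed
  ultimately have "\<exists>w\<in>closure E \<times> closure F. \<forall>w'\<in>closure E \<times> closure F. G w' \<le> G w"
    by (rule continuous_attains_sup)
  then obtain w where w: "w \<in> closure E \<times> closure F" "\<And>w'. w' \<in> closure E \<times> closure F \<Longrightarrow> G w' \<le> G w"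
    by blast
  obtain p q where pq: "w = (p, q)" by (cases w)
  have p: "p \<in> closure E" "q \<in> closure F" using w(1) pq by auto
  have mx: "z x * z y * exp (- N * (dist x y)\<^sup>2) \<le> z p * z q * exp (- N * (dist p q)\<^sup>2)"
    if "x \<in> closure E" "y \<in> closure F" for x y
    using w(2)[of "(x, y)"] that by (simp add: G_def pq)
  have lower: "a * exp (- N * (dist x1 y1)\<^sup>2) \<le> z p * z q * exp (- N * (dist p q)\<^sup>2)"
    using mx[OF cl1] by (simp add: a_def)
  have "0 < a * exp (- N * (dist x1 y1)\<^sup>2)" using a by simp
  with lower have "0 < z p * z q * exp (- N * (dist p q)\<^sup>2)" by (rule less_le_trans[rotated])
  then have "z p * z q > 0" by (simp add: zero_less_mult_iff)
  then have zp: "z p > 0" "z q > 0" using z(2)[of p] z(2)[of q] p by (auto simp: zero_less_mult_iff)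
  have "dist p q < d"
  proof (rule ccontr)
    assume "\<not> dist p q < d"
    then have dd: "d\<^sup>2 \<le> (dist p q)\<^sup>2" using d by (intro power_mono) auto
    have "(dist x1 y1)\<^sup>2 \<le> (d / 2)\<^sup>2" using d1 by (intro power_mono) auto
    then have "N * (dist x1 y1)\<^sup>2 \<le> N * (d\<^sup>2 / 4)" using N by (intro mult_left_mono) (auto simp: power_divide)
    then have "a * exp (- N * (d\<^sup>2 / 4)) \<le> a * exp (- N * (dist x1 y1)\<^sup>2)" using a by simp
    also note lower
    also have "z p * z q * exp (- N * (dist p q)\<^sup>2) \<le> c\<^sup>2 * exp (- N * d\<^sup>2)"
    proof (rule mult_mono)
      show "z p * z q \<le> c\<^sup>2" unfolding power2_eq_square using z(2)[of p] z(2)[of q] p by (intro mult_mono) auto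
      show "exp (- N * (dist p q)\<^sup>2) \<le> exp (- N * d\<^sup>2)" using N dd by simp
    qed auto
    finally have le: "a * exp (- N * (d\<^sup>2 / 4)) \<le> c\<^sup>2 * exp (- N * d\<^sup>2)" .
    have "a * exp (- N * (d\<^sup>2 / 4)) * exp (N * d\<^sup>2) \<le> c\<^sup>2 * exp (- N * d\<^sup>2) * exp (N * d\<^sup>2)"
      using le by (intro mult_right_mono) auto
    then have "a * exp (N * (3 / 4 * d\<^sup>2)) \<le> c\<^sup>2"
      by (simp add: exp_add[symmetric] algebra_simps)
    then have "exp (N * (3 / 4 * d\<^sup>2)) \<le> c\<^sup>2 / a" using a by (simp add: le_divide_eq mult.commute)
    then have "N * (3 / 4 * d\<^sup>2) \<le> ln (c\<^sup>2 / a)"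
      by (rule iffD2[OF ln_ge_iff, rotated]) (use a c in simp)
    then show False unfolding Nd by linarith
  qed
  then show thesis using that[OF p zp _ N mx] by blast
qed

section \<open>Doubling of variables and the contradiction\<close>

context C1_subsolution
begin

lemma frontier_connected:
  assumes "connected \<Omega>" "bounded \<Omega>" and blow: "blows_up_at_boundary \<Omega> u"
  shows "connected (frontier \<Omega>)"
proof (rule ccontr)
  assume nc: "\<not> connected (frontier \<Omega>)"
  have Vc: "continuous_on (closure \<Omega>) V" by (rule continuous_on_V_closure[OF blow])
  have frO: "frontier \<Omega> \<inter> \<Omega> = {}" using \<Omega> by (auto simp: frontier_def interior_open)
  obtain c E F where c: "c > 0" and E: "open E" and F: "open F" and EF0: "E \<inter> F = {}"
    and EF: "E \<union> F = {x\<in>\<Omega>. V x < c}" and ne: "closure E \<inter> closure F \<noteq> {}"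
    and meet: "closure E \<inter> closure F \<subseteq> \<Omega>"
  proof (rule mountain_pass_splitting[OF \<Omega> assms(1,2) nc Vc])
    show "V x = 0" if "x \<in> frontier \<Omega>" for x using that frO by (auto simp: V_def)
  qed (use V_pos V_no_local_min in blast)+
  have EFO: "E \<subseteq> \<Omega>" "F \<subseteq> \<Omega>" using EF by auto
  have disj: "E \<inter> closure F = {}" "F \<inter> closure E = {}"
    using open_Int_closure_eq_empty[OF E, of F] open_Int_closure_eq_empty[OF F, of E] EF0 by auto
  \<comment> \<open>Disjoint open sets do not meet each other's closures, while a common closure
    point below level c would have to lie in E or in F.\<close>
  have meet_c: "V l \<ge> c" if "l \<in> closure E" "l \<in> closure F" for l
  proof (rule ccontr)
    assume "\<not> c \<le> V l"
    then have "l \<in> E \<union> F" unfolding EF using that meet by auto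
    then show False using that disj by auto
  qed
  \<comment> \<open>The gradient threshold required by
    \<open>log_strictly_subharmonic\<close>.\<close>
  define h where "h = c / 2 * sqrt (\<epsilon> / 2)"
  have h: "h > 0" using c eps by (simp add: h_def)
  \<comment> \<open>By compactness, points of the two closures that are close to each other are
    close to a common closure point. Such a point lies in \<Omega> with V \<ge> c, and there V and
    its gradient are continuous; the gradient need not be uniformly continuous up to the
    frontier.\<close>
  have "\<exists>d>0. \<forall>x\<in>closure E. \<forall>y\<in>closure F. dist x y < d \<longrightarrow>
      x \<in> \<Omega> \<and> y \<in> \<Omega> \<and> c / 2 < V x \<and> c / 2 < V y \<and> norm (GV x - GV y) < h"
  proof (rule ccontr)
    assume neg: "\<not> ?thesis"
    let ?P = "\<lambda>x y. x \<in> \<Omega> \<and> y \<in> \<Omega> \<and> c / 2 < V x \<and> c / 2 < V y \<and> norm (GV x - GV y) < h"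
    have "\<forall>j::nat. \<exists>x y. x \<in> closure E \<and> y \<in> closure F \<and> dist x y < inverse (real (Suc j)) \<and> \<not> ?P x y"
      using neg by (metis inverse_positive_iff_positive of_nat_0_less_iff zero_less_Suc)
    then obtain X Y where XY: "\<And>j. X j \<in> closure E" "\<And>j. Y j \<in> closure F"
        "\<And>j. dist (X j) (Y j) < inverse (real (Suc j))" "\<And>j. \<not> ?P (X j) (Y j)"
      by metis
    have "compact (closure E)" using assms(2) EFO bounded_subset by (metis compact_closure)
    then obtain l r where l: "l \<in> closure E" "strict_mono r" "(X \<circ> r) \<longlonglongrightarrow> l"
      using XY(1) unfolding compact_def by metis
    have dXY: "(\<lambda>j. dist (X j) (Y j)) \<longlonglongrightarrow> 0"
    proof (rule tendsto_sandwich[OF _ _ tendsto_const LIMSEQ_inverse_real_of_nat])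
      show "\<forall>\<^sub>F j in sequentially. dist (X j) (Y j) \<le> inverse (real (Suc j))"
        using XY(3) by (simp add: less_imp_le)
    qed simp
    have "((\<lambda>j. dist (X j) (Y j)) \<circ> r) \<longlonglongrightarrow> 0" by (rule LIMSEQ_subseq_LIMSEQ[OF dXY l(2)])
    then have "(\<lambda>j. norm ((Y \<circ> r) j - (X \<circ> r) j)) \<longlonglongrightarrow> 0"
      by (simp add: o_def dist_norm norm_minus_commute)
    then have "(\<lambda>j. (Y \<circ> r) j - (X \<circ> r) j) \<longlonglongrightarrow> 0" by (rule tendsto_norm_zero_cancel)
    with l(3) have Yl: "(Y \<circ> r) \<longlonglongrightarrow> l" by (rule Lim_transform)
    have lF: "l \<in> closure F"
      by (rule Lim_in_closed_set[OF closed_closure _ _ Yl]) (use XY(2) in auto)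
    have lO: "l \<in> \<Omega>" using l(1) lF meet by blast
    have Vl: "c / 2 < V l" using meet_c[OF l(1) lF] c by simp
    have cV: "isCont V l" and cG: "isCont GV l"
      using continuous_on_V continuous_on_GV \<Omega> lO by (auto simp: continuous_on_eq_continuous_at)
    have ev: "\<forall>\<^sub>F j in sequentially. Z j \<in> \<Omega> \<and> c / 2 < V (Z j)" if "Z \<longlonglongrightarrow> l" for Z
      using topological_tendstoD[OF that \<Omega> lO] order_tendstoD(1)[OF isCont_tendsto_compose[OF cV that] Vl]
      by (rule eventually_conj)
    have "(\<lambda>j. norm (GV ((X \<circ> r) j) - GV ((Y \<circ> r) j))) \<longlonglongrightarrow> norm (GV l - GV l)"
      by (intro tendsto_intros isCont_tendsto_compose[OF cG] l(3) Yl)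
    then have "\<forall>\<^sub>F j in sequentially. norm (GV ((X \<circ> r) j) - GV ((Y \<circ> r) j)) < h"
      by (rule order_tendstoD) (use h in simp)
    then have "\<forall>\<^sub>F j in sequentially. ?P ((X \<circ> r) j) ((Y \<circ> r) j)"
      using ev[OF l(3)] ev[OF Yl] by eventually_elim blast
    then show False using XY(4) by (auto simp: eventually_sequentially)
  qed
  then obtain d where d: "d > 0" and close: "\<And>x y. x \<in> closure E \<Longrightarrow> y \<in> closure F \<Longrightarrow> dist x y < d \<Longrightarrow>
      x \<in> \<Omega> \<and> y \<in> \<Omega> \<and> c / 2 < V x \<and> c / 2 < V y \<and> norm (GV x - GV y) < h" by blast
  define z where "z = (\<lambda>x. c - V x)"
  obtain x0 where x0: "x0 \<in> closure E" "x0 \<in> closure F" using ne by blast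
  have sub: "closure E \<union> closure F \<subseteq> closure \<Omega>" using EFO closure_mono by blast
  have Vle: "V x \<le> c" if "x \<in> closure E \<union> closure F" for x
  proof -
    have "closed {x \<in> closure \<Omega>. V x \<le> c}"
      using continuous_closed_preimage[OF Vc closed_closure closed_atMost[of c]]
      by (simp add: vimage_def Int_def)
    moreover have "E \<union> F \<subseteq> {x \<in> closure \<Omega>. V x \<le> c}" unfolding EF using closure_subset[of \<Omega>] by auto
    ultimately have "closure (E \<union> F) \<subseteq> {x \<in> closure \<Omega>. V x \<le> c}" by (intro closure_minimal)
    then show ?thesis using that by auto
  qed
  have "bounded E" "bounded F" using EFO assms(2) bounded_subset by auto
  then obtain p q N where p: "p \<in> closure E" and q: "q \<in> closure F" and zpq: "z p > 0" "z q > 0"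
    and dpq: "dist p q < d" and N: "N > 0"
    and mx: "\<And>x y. x \<in> closure E \<Longrightarrow> y \<in> closure F \<Longrightarrow>
      z x * z y * exp (- N * (dist x y)\<^sup>2) \<le> z p * z q * exp (- N * (dist p q)\<^sup>2)"
  proof (rule maximizing_pair[OF E _ F _ x0, where z = z and c = c and d = d])
    show "continuous_on (closure E \<union> closure F) z"
      unfolding z_def by (intro continuous_intros continuous_on_subset[OF Vc sub])
    show "0 \<le> z x \<and> z x \<le> c" if "x \<in> closure E \<union> closure F" for x
      using Vle[OF that] V_nonneg[of x] by (simp add: z_def)
    show "0 < z x" if "x \<in> E \<union> F" for x using that unfolding EF by (simp add: z_def)
  qed (use d in blast)+
  note pq = close[OF p q dpq]
  \<comment> \<open>Being in \<Omega> below level c puts p in E or F, and a point of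
    \<open>closure E\<close> is not in the open set F. So p and q are interior points, where
    derivatives can be compared.\<close>
  have pE: "p \<in> E" using pq zpq(1) p disj EF by (auto simp: z_def)
  have qF: "q \<in> F" using pq zpq(2) q disj EF by (auto simp: z_def)
  have zE: "z x > 0" if "x \<in> E \<union> F" for x using that unfolding EF by (simp add: z_def)
  have in_cl: "x \<in> closure E" if "x \<in> E" for x using that closure_subset by blast
  have in_cl': "x \<in> closure F" if "x \<in> F" for x using that closure_subset by blast
  have lmx: "ln (z x) + ln (z y) - N * (dist x y)\<^sup>2 \<le> ln (z p) + ln (z q) - N * (dist p q)\<^sup>2"
    if "x \<in> E" "y \<in> F" for x y
  proof -
    have pos: "z x > 0" "z y > 0" using zE that by auto
    have "ln (z x * z y * exp (- N * (dist x y)\<^sup>2)) \<le> ln (z p * z q * exp (- N * (dist p q)\<^sup>2))"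
      using mx[OF in_cl in_cl'] that pos zpq by simp
    then show ?thesis using pos zpq by (simp add: ln_mult)
  qed
  have "p \<noteq> q" using pE qF EF0 by auto
  have dz: "((\<lambda>x. ln (z x)) has_derivative (\<lambda>v. (- (1 / z x) *\<^sub>R GV x) \<bullet> v)) (at x)" if "x \<in> \<Omega>" "z x > 0" for x
    using that(2) unfolding z_def
    by (auto intro!: derivative_eq_intros V_has_derivative that simp: fun_eq_iff divide_inverse)
  have dq: "((\<lambda>x. N * (dist x a)\<^sup>2 + k) has_derivative (\<lambda>v. ((2 * N) *\<^sub>R (x - a)) \<bullet> v)) (at x)" for a x :: "real^'n" and k
    unfolding dist_norm power2_norm_eq_inner
    by (rule has_derivative_eq_rhs) (auto intro!: derivative_eq_intros simp: fun_eq_iff inner_commute algebra_simps)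
  have "- (1 / z p) *\<^sub>R GV p = (2 * N) *\<^sub>R (p - q)"
    by (rule gradient_eq_at_touching[OF E pE dz dq[where k = "ln (z p) - N * (dist p q)\<^sup>2"]])
       (use pq zpq lmx[OF _ qF] in \<open>auto simp: algebra_simps\<close>)
  then have "- z p *\<^sub>R (- (1 / z p) *\<^sub>R GV p) = - z p *\<^sub>R ((2 * N) *\<^sub>R (p - q))" by simp
  then have Gp: "GV p = (- (2 * N * z p)) *\<^sub>R (p - q)" using zpq by (simp add: mult.commute)
  have "- (1 / z q) *\<^sub>R GV q = (2 * N) *\<^sub>R (q - p)"
    by (rule gradient_eq_at_touching[OF F qF dz dq[where k = "ln (z q) - N * (dist p q)\<^sup>2"]])
       (use pq zpq lmx[OF pE] in \<open>auto simp: algebra_simps dist_commute\<close>)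
  then have "- z q *\<^sub>R (- (1 / z q) *\<^sub>R GV q) = - z q *\<^sub>R ((2 * N) *\<^sub>R (q - p))" by simp
  then have "GV q = (- (2 * N * z q)) *\<^sub>R (q - p)" using zpq by (simp add: mult.commute)
  then have Gq: "GV q = (2 * N * z q) *\<^sub>R (p - q)" by (simp add: scaleR_diff_right)
  \<comment> \<open>The coefficients of p - q have opposite signs at p and q, so the norms of the
    two gradients add up in their difference. This bounds N (z p + z q) |p - q| although N |p - q|
    itself may be large.\<close>
  have Gsub: "GV p - GV q = (- (2 * N * (z p + z q))) *\<^sub>R (p - q)"
    unfolding Gp Gq by (simp add: scaleR_diff_left[symmetric] algebra_simps)
  have small: "2 * N * (z p + z q) * norm (p - q) < h" using pq N zpq unfolding Gsub by simp
  have "norm (GV p) \<le> 2 * N * (z p + z q) * norm (p - q)"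
    unfolding Gp using N zpq by (auto intro!: mult_right_mono)
  then have gp: "norm (GV p) < c / 2 * sqrt (\<epsilon> / 2)" using small by (simp add: h_def)
  have "norm (GV q) \<le> 2 * N * (z p + z q) * norm (p - q)"
    unfolding Gq using N zpq by (auto intro!: mult_right_mono)
  then have gq: "norm (GV q) < c / 2 * sqrt (\<epsilon> / 2)" using small by (simp add: h_def)
  define e where "e = (1 / norm (p - q)) *\<^sub>R (p - q)"
  have ne: "norm e = 1" using \<open>p \<noteq> q\<close> by (simp add: e_def)
  have pqe: "p - q = norm (p - q) *\<^sub>R e" using \<open>p \<noteq> q\<close> by (simp add: e_def)
  obtain B where B: "frame e B" using ex_frame[OF ne] .
  interpret frame e B by fact
  have orth_pq: "(p - q) \<bullet> b = 0" if "b \<in> B" for b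
    using inner_eB(1)[OF that] by (subst pqe) simp
  obtain r1 where r1: "r1 > 0" "\<And>\<rho>. 0 < \<rho> \<Longrightarrow> \<rho> \<le> r1 \<Longrightarrow>
      strictly_subharmonic_viscosity (\<epsilon> / 4) \<rho> (\<lambda>v. ln (c - V (p + v)))"
    using log_strictly_subharmonic[OF B c _ _ _ gp] pq zpq(1) orth_pq by (auto simp: z_def Gp)
  obtain r2 where r2: "r2 > 0" "\<And>\<rho>. 0 < \<rho> \<Longrightarrow> \<rho> \<le> r2 \<Longrightarrow>
      strictly_subharmonic_viscosity (\<epsilon> / 4) \<rho> (\<lambda>v. ln (c - V (q + v)))"
    using log_strictly_subharmonic[OF B c _ _ _ gq] pq zpq(2) orth_pq by (auto simp: z_def Gq)
  obtain r3 where r3: "r3 > 0" "cball p r3 \<subseteq> E" using E pE open_contains_cball by blast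
  obtain r4 where r4: "r4 > 0" "cball q r4 \<subseteq> F" using F qF open_contains_cball by blast
  define \<rho> where "\<rho> = min (min r1 r2) (min r3 r4)"
  have \<rho>: "\<rho> > 0" "\<rho> \<le> r1" "\<rho> \<le> r2" "\<rho> \<le> r3" "\<rho> \<le> r4" using r1 r2 r3 r4 by (auto simp: \<rho>_def)
  have "B \<noteq> {}" using card_B n by force
  then show False
  proof (rule no_max_of_sum[OF _ \<rho>(1) _ r1(2)[OF \<rho>(1,2)] r2(2)[OF \<rho>(1,3)]])
    show "0 < \<epsilon> / 4" using eps by simp
    fix v :: "real^'n" assume v: "v \<in> cball 0 \<rho>"
    \<comment> \<open>Translating both points by v preserves their distance, so the penalties on the
      two sides of \<open>lmx\<close> cancel.\<close>
    have "p + v \<in> E" "q + v \<in> F" using v \<rho> r3(2) r4(2) by (auto simp: dist_norm subset_iff)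
    from lmx[OF this] show "ln (c - V (p + v)) + ln (c - V (q + v)) \<le> ln (c - V (p + 0)) + ln (c - V (q + 0))"
      by (simp add: z_def)
  qed
qed

end

theorem theorem1p1:
  fixes \<Omega> :: "(real^'n::finite) set" and k :: nat
  assumes "CARD('n) \<ge> 3"
    and "open \<Omega>" and "connected \<Omega>" and "\<Omega> \<noteq> {}" and "bounded \<Omega>"
    and "smooth_boundary \<Omega>"
    and "\<not> connected (frontier \<Omega>)"
    and "2 \<le> k" and "k \<le> CARD('n)"
  shows "(\<nexists>u. bvp_solution k \<Omega> u \<and> Ck_on 1 \<Omega> u) \<and>
    (\<forall>u. bvp_solution k \<Omega> u \<and> locally_lipschitz_on \<Omega> u \<and>
         (\<forall>v. bvp_solution k \<Omega> v \<longrightarrow> (\<forall>x\<in>\<Omega>. v x = u x)) \<longrightarrow> \<not> Ck_on 1 \<Omega> u)"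
proof -
  have "\<not> Ck_on 1 \<Omega> u" if sol: "bvp_solution k \<Omega> u" for u
  proof
    assume C1: "Ck_on 1 \<Omega> u"
    obtain R where R: "R > 0" "\<And>x. x \<in> \<Omega> \<Longrightarrow> norm x \<le> R"
      using assms(5) bounded_pos by metis
    interpret C1_subsolution \<Omega> k u R
      using assms sol C1 R by unfold_locales (auto simp: bvp_solution_def)
    have "blows_up_at_boundary \<Omega> u" using sol by (simp add: bvp_solution_def)
    then show False using frontier_connected assms(3,5,7) by blast
  qed
  then show ?thesis by blast
qed

end
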